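(* Let $f$ and $g$ be entire functions of finite genus $0\le\rho<+\infty$ with respective sets of zeros $(\alpha_i)$ and $(\beta_j)$ (counted with multiplicity), and assume $f(0)=g(0)=1$. Consider the Hadamard–Weierstrass factorizations $$f(z)=e^{F(z)}\prod_iE_\rho\left(\frac{z}{\alpha_i}\right),\qquad g(z)=e^{G(z)}\prod_jE_\rho\left(\frac{z}{\beta_j}\right),$$ where $F$ and $G$ are polynomials of degree $\le\rho$ vanishing at $0$. Then $F\star_eG$ is a polynomial of degree $\le\rho$ and $$f\star g(z)=e^{F\star_eG(z)}\prod_{i,j}E_\rho\left(\frac{z}{\alpha_i\beta_j}\right).$$
   Context: $E_N(z)=(1-z)\exp\left(z+\frac{z^2}2+\dots+\frac{z^N}N\right)$ is the Weierstrass factor ($E_0(z)=1-z$). The genus of an entire function $f$ with $f(0)=1$ is the minimal integer $\rho\ge0$ such that $f(z)=e^{F(z)}\prod_iE_\rho(z/\alpha_i)$ with $F\in\mathbb{C}[z]$ of degree $\le\rho$ and the product converging absolutely and uniformly on compact subsets of $\mathbb{C}$. For $F=\sum_{i\ge1}F_iz^i$ and $G=\sum_{i\ge1}G_iz^i$ in $z\mathbb{C}[[z]]$, $F\star_eG=-\sum_{i\ge1}i\,F_iG_i\,z^i$. Eñe product: for $n\ge1$, let $Q_n\in\mathbb{Z}[X_1,\dots,X_n,Y_1,\dots,Y_n]$ be the unique polynomial such that in $\mathbb{Z}[x_1,\dots,x_n,y_1,\dots,y_n]$ the $n$-th elementary symmetric polynomial of the $n^2$ products $x_iy_j$ equals $Q_n(e_1(x),\dots,e_n(x),e_1(y),\dots,e_n(y))$,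 where $e_k$ are the elementary symmetric polynomials. For $f=1+\sum_{n\ge1}a_nz^n$ and $g=1+\sum_{n\ge1}b_nz^n$ in $1+z\mathbb{C}[[z]]$, $f\star g=1+\sum_{n\ge1}c_nz^n$ with $c_n=(-1)^nQ_n(a_1,\dots,a_n,b_1,\dots,b_n)$. *)

theory Defs
  imports
    "HOL-Complex_Analysis.Complex_Analysis"
    "HOL-Library.Poly_Mapping"
begin

section \<open>Integer polynomials in several variables\<close>

type_synonym 'v int_mpoly = "('v \<Rightarrow>\<^sub>0 nat) \<Rightarrow>\<^sub>0 int"

definition Var :: "'v \<Rightarrow> 'v int_mpoly" where
  "Var v = Poly_Mapping.single (Poly_Mapping.single v 1) 1"

definition vars :: "'v int_mpoly \<Rightarrow> 'v set" where
  "vars p = (\<Union>m\<in>Poly_Mapping.keys p. Poly_Mapping.keys m)"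

definition mpoly_eval :: "('v \<Rightarrow> 'a::comm_ring_1) \<Rightarrow> 'v int_mpoly \<Rightarrow> 'a" where
  "mpoly_eval \<phi> p =
     (\<Sum>m\<in>Poly_Mapping.keys p. of_int (Poly_Mapping.lookup p m) *
        (\<Prod>v\<in>Poly_Mapping.keys m. \<phi> v ^ Poly_Mapping.lookup m v))"

text \<open>The \<open>k\<close>-th elementary symmetric polynomial of the family \<open>x i\<close>, \<open>i \<in> A\<close> (\<open>A\<close> finite).\<close>

definition esym :: "nat \<Rightarrow> 'i set \<Rightarrow> ('i \<Rightarrow> 'a::comm_ring_1) \<Rightarrow> 'a" where
  "esym k A x = (\<Sum>S | S \<subseteq> A \<and> card S = k. \<Prod>i\<in>S. x i)"

section \<open>The e\~ne product\<close>

text \<open>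
  \<open>Var (Inl i)\<close> and \<open>Var (Inr j)\<close> play the role of \<open>X\<^sub>i\<close>, \<open>Y\<^sub>j\<close> in \<open>Q\<close>, and that of
  \<open>x\<^sub>i\<close>, \<open>y\<^sub>j\<close> in the identity that characterises \<open>Q\<close>.
\<close>

definition is_ene_poly :: "nat \<Rightarrow> (nat + nat) int_mpoly \<Rightarrow> bool" where
  "is_ene_poly n Q \<longleftrightarrow>
     vars Q \<subseteq> Inl ` {1..n} \<union> Inr ` {1..n} \<and>
     esym n ({1..n} \<times> {1..n}) (\<lambda>(i, j). Var (Inl i) * Var (Inr j) :: (nat + nat) int_mpoly) =
       mpoly_eval (case_sum (\<lambda>k. esym k {1..n} (\<lambda>i. Var (Inl i)))
                            (\<lambda>k. esym k {1..n} (\<lambda>j. Var (Inr j)))) Q"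

definition ene_poly :: "nat \<Rightarrow> (nat + nat) int_mpoly" where
  "ene_poly n = (THE Q. is_ene_poly n Q)"

definition ene_prod :: "complex fps \<Rightarrow> complex fps \<Rightarrow> complex fps"  (infixl \<open>\<star>\<close> 70) where
  "f \<star> g = Abs_fps (\<lambda>n. if n = 0 then 1
     else (-1) ^ n * mpoly_eval (case_sum (fps_nth f) (fps_nth g)) (ene_poly n))"

definition exp_ene_prod :: "complex fps \<Rightarrow> complex fps \<Rightarrow> complex fps"  (infixl \<open>\<star>\<^sub>e\<close> 70) where
  "F \<star>\<^sub>e G = Abs_fps (\<lambda>i. - (of_nat i * fps_nth F i * fps_nth G i))"

section \<open>Infinite products over index sets\<close>

definition infprod :: "('i \<Rightarrow> complex) \<Rightarrow> 'i set \<Rightarrow> complex" where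
  "infprod u I = Lim (finite_subsets_at_top I) (\<lambda>S. \<Prod>i\<in>S. u i)"

definition abs_unif_convergent_prod :: "('i \<Rightarrow> complex \<Rightarrow> complex) \<Rightarrow> 'i set \<Rightarrow> bool" where
  "abs_unif_convergent_prod u I \<longleftrightarrow>
     (\<forall>z. (\<lambda>i. norm (u i z - 1)) summable_on I) \<and>
     (\<forall>K. compact K \<longrightarrow>
        uniform_limit K (\<lambda>S z. \<Prod>i\<in>S. u i z) (\<lambda>z. infprod (\<lambda>i. u i z) I)
          (finite_subsets_at_top I))"

section \<open>Hadamard--Weierstrass factorizations and genus\<close>

text \<open>
  The family \<open>\<alpha> i\<close>, \<open>i \<in> I\<close>, lists the zeros of \<open>f\<close> with multiplicity. For an entire function
  \<open>f\<close> that is not identically zero, \<open>zorder f z\<close> is \<open>0\<close> where \<open>f\<close> does not vanish. If \<open>f 0 = 1\<close>,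
  then all \<open>\<alpha> i\<close> are nonzero, so that the quotients \<open>z / \<alpha> i\<close> below are meaningful.
\<close>

definition zeros_family :: "(complex \<Rightarrow> complex) \<Rightarrow> 'i set \<Rightarrow> ('i \<Rightarrow> complex) \<Rightarrow> bool" where
  "zeros_family f I \<alpha> \<longleftrightarrow>
     (\<forall>z. finite {i\<in>I. \<alpha> i = z} \<and> int (card {i\<in>I. \<alpha> i = z}) = zorder f z)"

definition hadamard_factorization ::
    "nat \<Rightarrow> (complex \<Rightarrow> complex) \<Rightarrow> complex poly \<Rightarrow> 'i set \<Rightarrow> ('i \<Rightarrow> complex) \<Rightarrow> bool" where
  "hadamard_factorization \<rho> f F I \<alpha> \<longleftrightarrow>
     Polynomial.degree F \<le> \<rho> \<and>
     abs_unif_convergent_prod (\<lambda>i z. weierstrass_factor \<rho> (z / \<alpha> i)) I \<and>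
     (\<forall>z. f z = exp (poly F z) * infprod (\<lambda>i. weierstrass_factor \<rho> (z / \<alpha> i)) I)"

text \<open>The zeros of an entire function are countable, so index sets of natural numbers suffice here.\<close>

definition admits_factorization :: "(complex \<Rightarrow> complex) \<Rightarrow> nat \<Rightarrow> bool" where
  "admits_factorization f \<rho> \<longleftrightarrow>
     (\<exists>F (I :: nat set) \<alpha>. zeros_family f I \<alpha> \<and> hadamard_factorization \<rho> f F I \<alpha>)"

definition has_genus :: "(complex \<Rightarrow> complex) \<Rightarrow> nat \<Rightarrow> bool" where
  "has_genus f \<rho> \<longleftrightarrow>
     admits_factorization f \<rho> \<and> (\<forall>\<sigma><\<rho>. \<not> admits_factorization f \<sigma>)"

end

(* The e~ne product is multiplication of zeros: in terms of the power sums P_n(f) defined by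
   -z f'/f = sum_n P_n(f) z^n it is P_n(f * g) = P_n(f) P_n(g). This makes sense of f * g once Q_n
   is known to exist, which is seen without symmetric function theory: a power series with constant
   coefficient 1 is an infinite product of factors 1 - a z^k with a an integer polynomial in the
   coefficients, and the product of two such factors is again explicit. Uniqueness of Q_n follows
   from the fundamental theorem of algebra.

   For an entire function given by its Hadamard factorization, Newton's identities pass to the limit
   along the partial products and give P_n = -n F_n for n <= rho and P_n = sum_i alpha_i^(-n) for
   n > rho. Multiplying these for f and g gives the P_n of the claimed product, which converges
   because sum_i |alpha_i|^(-rho-1) and sum_j |beta_j|^(-rho-1) do. *)
theory Submission
  imports Defs "HOL-Computational_Algebra.Fundamental_Theorem_Algebra"
begin

section \<open>Evaluation of integer polynomials\<close>

text \<open>The obstacle is integrality. Recovering coefficients from power sums divides by n, so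
  Newton's identities alone would only produce Q_n over the rationals. The factors 1 - a_k z^k are
  reached by ring operations only, and the product of two of them is a power of one such factor; so
  the construction makes sense over Z[X, Y] and commutes with every ring homomorphism. Its
  correctness may nevertheless be checked by dividing by n: an integer polynomial is determined by
  its values at complex points, and over the complex numbers power sums determine the series. On the
  analytic side, \<open>f \<star> g\<close> is a priori only a formal power series. The claimed
  right-hand side is shown to be entire, and the two are compared at 0. Exponentials and zeros never
  mix, because the power sums of E_\<rho> vanish up to degree \<rho>, while those of exp F vanish
  above it.\<close>

definition monom_eval :: "('v \<Rightarrow> 'a::comm_ring_1) \<Rightarrow> ('v \<Rightarrow>\<^sub>0 nat) \<Rightarrow> 'a" where
  "monom_eval \<phi> m = (\<Prod>v\<in>Poly_Mapping.keys m. \<phi> v ^ Poly_Mapping.lookup m v)"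

lemma monom_eval_superset:
  assumes "finite A" "Poly_Mapping.keys m \<subseteq> A"
  shows "monom_eval \<phi> m = (\<Prod>v\<in>A. \<phi> v ^ Poly_Mapping.lookup m v)"
  unfolding monom_eval_def
  by (rule prod.mono_neutral_left) (use assms in \<open>auto simp: in_keys_iff\<close>)

lemma monom_eval_0 [simp]: "monom_eval \<phi> 0 = 1"
  by (simp add: monom_eval_def)

lemma monom_eval_add: "monom_eval \<phi> (m + m') = monom_eval \<phi> m * monom_eval \<phi> m'"
proof -
  let ?A = "Poly_Mapping.keys m \<union> Poly_Mapping.keys m'"
  have "monom_eval \<phi> x = (\<Prod>v\<in>?A. \<phi> v ^ Poly_Mapping.lookup x v)" if "x \<in> {m, m', m + m'}" for x
    using that Poly_Mapping.keys_add[of m m'] by (intro monom_eval_superset) auto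
  thus ?thesis
    by (simp add: lookup_add power_add prod.distrib)
qed

lemma mpoly_eval_superset:
  assumes "finite A" "Poly_Mapping.keys p \<subseteq> A"
  shows "mpoly_eval \<phi> p = (\<Sum>m\<in>A. of_int (Poly_Mapping.lookup p m) * monom_eval \<phi> m)"
  unfolding mpoly_eval_def monom_eval_def[symmetric]
  by (rule sum.mono_neutral_left) (use assms in \<open>auto simp: in_keys_iff\<close>)

lemma mpoly_eval_single: "mpoly_eval \<phi> (Poly_Mapping.single m c) = of_int c * monom_eval \<phi> m"
  by (subst mpoly_eval_superset[of "{m}"]) auto

lemma mpoly_eval_add: "mpoly_eval \<phi> (p + q) = mpoly_eval \<phi> p + mpoly_eval \<phi> q"
proof -
  let ?A = "Poly_Mapping.keys p \<union> Poly_Mapping.keys q"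
  have "mpoly_eval \<phi> x = (\<Sum>m\<in>?A. of_int (Poly_Mapping.lookup x m) * monom_eval \<phi> m)"
    if "x \<in> {p, q, p + q}" for x
    using that Poly_Mapping.keys_add[of p q] by (intro mpoly_eval_superset) auto
  thus ?thesis
    by (simp add: lookup_add algebra_simps sum.distrib)
qed

lemma mpoly_eval_0 [simp]: "mpoly_eval \<phi> 0 = 0"
  by (simp add: mpoly_eval_def)

lemma mpoly_eval_sum: "mpoly_eval \<phi> (sum f A) = (\<Sum>x\<in>A. mpoly_eval \<phi> (f x))"
  by (induction A rule: infinite_finite_induct) (auto simp: mpoly_eval_add)

lemma int_mpoly_as_sum:
  fixes p :: "'v int_mpoly"
  shows "p = (\<Sum>m\<in>Poly_Mapping.keys p. Poly_Mapping.single m (Poly_Mapping.lookup p m))"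
proof (rule poly_mapping_eqI)
  fix k
  show "Poly_Mapping.lookup p k = Poly_Mapping.lookup
      (\<Sum>m\<in>Poly_Mapping.keys p. Poly_Mapping.single m (Poly_Mapping.lookup p m)) k"
    by (simp add: lookup_sum lookup_single when_def sum.delta' in_keys_iff)
qed

lemma mpoly_eval_mult:
  fixes p q :: "'v int_mpoly"
  shows "mpoly_eval \<phi> (p * q) = mpoly_eval \<phi> p * mpoly_eval \<phi> q"
proof -
  let ?s = "\<lambda>p m. Poly_Mapping.single m (Poly_Mapping.lookup p m) :: 'v int_mpoly"
  have "p * q = (\<Sum>m\<in>Poly_Mapping.keys p. ?s p m) * (\<Sum>m\<in>Poly_Mapping.keys q. ?s q m)"
    by (rule arg_cong2[of _ _ _ _ "(*)"]; rule int_mpoly_as_sum)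
  also have "\<dots> = (\<Sum>m\<in>Poly_Mapping.keys p. \<Sum>m'\<in>Poly_Mapping.keys q. ?s p m * ?s q m')"
    by (rule sum_product)
  finally have "mpoly_eval \<phi> (p * q) =
      (\<Sum>m\<in>Poly_Mapping.keys p. \<Sum>m'\<in>Poly_Mapping.keys q. mpoly_eval \<phi> (?s p m * ?s q m'))"
    by (simp only: mpoly_eval_sum)
  also have "\<dots> = (\<Sum>m\<in>Poly_Mapping.keys p. \<Sum>m'\<in>Poly_Mapping.keys q.
         (of_int (Poly_Mapping.lookup p m) * monom_eval \<phi> m) *
         (of_int (Poly_Mapping.lookup q m') * monom_eval \<phi> m'))"
    by (simp add: mult_single mpoly_eval_single monom_eval_add mult_ac)
  also have "\<dots> = mpoly_eval \<phi> p * mpoly_eval \<phi> q"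
    by (simp only: sum_product mpoly_eval_def flip: monom_eval_def)
  finally show ?thesis .
qed

lemma mpoly_eval_1 [simp]: "mpoly_eval \<phi> 1 = 1"
  using mpoly_eval_single[of \<phi> 0 1] by simp

lemma mpoly_eval_Var [simp]: "mpoly_eval \<phi> (Var v) = \<phi> v"
  by (simp add: Var_def mpoly_eval_single monom_eval_def)

section \<open>Homomorphisms of commutative rings and evaluation\<close>

locale ring_hom_cr =
  fixes h :: "'a::comm_ring_1 \<Rightarrow> 'b::comm_ring_1"
  assumes hom_add: "h (x + y) = h x + h y"
    and hom_mult: "h (x * y) = h x * h y"
    and hom_1 [simp]: "h 1 = 1"
begin

lemma hom_0 [simp]: "h 0 = 0"
  using hom_add[of 0 0] by simp

lemma hom_uminus: "h (- x) = - h x"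
  using hom_add[of x "- x"] by (simp add: eq_neg_iff_add_eq_0 add.commute)

lemma hom_diff: "h (x - y) = h x - h y"
  using hom_add[of x "- y"] by (simp add: hom_uminus)

lemma hom_sum: "h (sum f A) = (\<Sum>x\<in>A. h (f x))"
  by (induction A rule: infinite_finite_induct) (auto simp: hom_add)

lemma hom_prod: "h (prod f A) = (\<Prod>x\<in>A. h (f x))"
  by (induction A rule: infinite_finite_induct) (auto simp: hom_mult)

lemma hom_power: "h (x ^ n) = h x ^ n"
  by (induction n) (auto simp: hom_mult)

lemma hom_of_nat: "h (of_nat n) = of_nat n"
  by (induction n) (auto simp: hom_add)

lemma hom_of_int: "h (of_int n) = of_int n"
  by (cases n) (auto simp: hom_of_nat hom_uminus hom_diff)

lemma hom_esym: "h (esym k A x) = esym k A (\<lambda>i. h (x i))"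
  by (simp add: esym_def hom_sum hom_prod)

lemma hom_mpoly_eval: "h (mpoly_eval \<phi> p) = mpoly_eval (\<lambda>v. h (\<phi> v)) p"
  by (simp add: mpoly_eval_def hom_sum hom_mult hom_prod hom_power hom_of_int)

end

lemma ring_hom_cr_mpoly_eval: "ring_hom_cr (mpoly_eval \<phi>)"
  by unfold_locales (simp_all add: mpoly_eval_add mpoly_eval_mult)

lemma mpoly_eval_cong:
  assumes "\<And>v. v \<in> vars p \<Longrightarrow> \<phi> v = \<psi> v"
  shows "mpoly_eval \<phi> p = mpoly_eval \<psi> p"
  unfolding mpoly_eval_def
proof (intro sum.cong prod.cong refl arg_cong2[of _ _ _ _ "(*)"])
  fix m v assume "m \<in> Poly_Mapping.keys p" "v \<in> Poly_Mapping.keys m"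
  thus "\<phi> v ^ Poly_Mapping.lookup m v = \<psi> v ^ Poly_Mapping.lookup m v"
    using assms[of v] by (simp add: vars_def bexI[of _ m])
qed

text \<open>
  The exponents \<open>m\<close> are told apart by the integers \<open>\<Prod>v. p\<^sub>v ^ m v\<close> for distinct primes \<open>p\<^sub>v\<close>, and
  evaluating at all the points \<open>(p\<^sub>v ^ t)\<close>, \<open>t \<in> \<nat>\<close>, isolates each coefficient by interpolation.
\<close>
lemma int_mpoly_eqI_eval:
  fixes p q :: "'v::countable int_mpoly"
  assumes "\<And>\<phi>. mpoly_eval \<phi> p = (mpoly_eval \<phi> q :: complex)"
  shows "p = q"
proof -
  define r where "r = p - q"
  define P where "P = (\<lambda>v::'v. enumerate {p::nat. prime p} (to_nat v))"
  have prime_P: "prime (P v)" for v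
    using enumerate_in_set[OF primes_infinite, of "to_nat v"] by (simp add: P_def)
  have "inj P"
    using strict_mono_eq[OF strict_mono_enumerate[OF primes_infinite]]
    by (simp add: P_def inj_def)
  define N where "N = (\<lambda>m. \<Prod>v\<in>Poly_Mapping.keys m. P v ^ Poly_Mapping.lookup m v)"
  have mult_N: "multiplicity (P v) (N m) = Poly_Mapping.lookup m v" for m v
  proof -
    have "N m = (\<Prod>x\<in>P ` Poly_Mapping.keys m. x ^ (Poly_Mapping.lookup m (inv P x)))"
      using \<open>inj P\<close> by (subst prod.reindex) (auto simp: N_def inj_on_def)
    also have "multiplicity (P v) \<dots> = (if P v \<in> P ` Poly_Mapping.keys m
                 then Poly_Mapping.lookup m (inv P (P v)) else 0)"
      using prime_P by (intro multiplicity_prod_prime_powers) auto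
    finally show ?thesis
      using \<open>inj P\<close> by (auto simp: inj_image_mem_iff in_keys_iff)
  qed
  have "inj N"
    by (rule injI, rule poly_mapping_eqI) (metis mult_N)
  have moment: "(\<Sum>m\<in>Poly_Mapping.keys r. of_int (Poly_Mapping.lookup r m) * of_nat (N m) ^ t) = (0::complex)" for t
  proof -
    define \<phi> where "\<phi> = (\<lambda>v. of_nat (P v) ^ t :: complex)"
    interpret ring_hom_cr "mpoly_eval \<phi>"
      by (rule ring_hom_cr_mpoly_eval)
    have "mpoly_eval \<phi> r = 0"
      using assms[of \<phi>] by (simp add: r_def hom_diff)
    moreover have "monom_eval \<phi> m = of_nat (N m) ^ t" for m
      by (simp add: monom_eval_def N_def \<phi>_def prod_power_distrib power_mult[symmetric] mult.commute)
    ultimately show ?thesis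
      by (simp add: mpoly_eval_def monom_eval_def)
  qed
  have zero: "(\<Sum>m\<in>Poly_Mapping.keys r. of_int (Poly_Mapping.lookup r m) * poly s (of_nat (N m))) = (0::complex)" for s
  proof -
    have "(\<Sum>m\<in>Poly_Mapping.keys r. of_int (Poly_Mapping.lookup r m) * poly s (of_nat (N m)))
       = (\<Sum>t\<le>Polynomial.degree s. coeff s t * (\<Sum>m\<in>Poly_Mapping.keys r. of_int (Poly_Mapping.lookup r m) * of_nat (N m) ^ t))"
      by (simp add: poly_altdef sum_distrib_left mult_ac sum.swap[of _ "{.._}"])
    thus ?thesis
      by (simp add: moment)
  qed
  have "Poly_Mapping.lookup r m = 0" for m
  proof (rule ccontr)
    assume m: "Poly_Mapping.lookup r m \<noteq> 0"
    \<comment> \<open>\<open>s\<close> vanishes at every node \<open>N m'\<close> other than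
      \<open>N m\<close>, so in \<open>zero\<close> only the coefficient of \<open>m\<close>
      survives; injectivity of \<open>N\<close> keeps \<open>s\<close> from vanishing at
      \<open>N m\<close> as well.\<close>
    define s :: "complex poly" where "s = (\<Prod>m'\<in>Poly_Mapping.keys r - {m}. [:- of_nat (N m'), 1:])"
    have "(\<Sum>m'\<in>Poly_Mapping.keys r. of_int (Poly_Mapping.lookup r m') * poly s (of_nat (N m'))) =
          (\<Sum>m'\<in>{m}. of_int (Poly_Mapping.lookup r m') * poly s (of_nat (N m')))"
      by (rule sum.mono_neutral_right) (use m in \<open>auto simp: s_def poly_prod in_keys_iff\<close>)
    hence "poly s (of_nat (N m)) = 0"
      using zero[of s] m by simp
    then obtain m' where "m' \<noteq> m" "N m = N m'"
      by (auto simp: s_def poly_prod)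
    with \<open>inj N\<close> show False
      by (auto simp: inj_def)
  qed
  hence "r = 0"
    by (intro poly_mapping_eqI) simp
  thus ?thesis
    by (simp add: r_def)
qed

section \<open>Variables occurring in a polynomial\<close>

lemma vars_add: "vars (p + q) \<subseteq> vars p \<union> vars q"
  unfolding vars_def using Poly_Mapping.keys_add[of p q] by blast

lemma vars_mult: "vars (p * q) \<subseteq> vars p \<union> vars q"
proof
  fix v assume "v \<in> vars (p * q)"
  then obtain m m' where "m \<in> Poly_Mapping.keys p" "m' \<in> Poly_Mapping.keys q"
    "v \<in> Poly_Mapping.keys (m + m')"
    unfolding vars_def using keys_mult[of p q] by blast
  thus "v \<in> vars p \<union> vars q"
    unfolding vars_def using Poly_Mapping.keys_add[of m m'] by blast
qed

lemma vars_1 [simp]: "vars 1 = {}"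
  by (simp add: vars_def)

lemma vars_of_int [simp]: "vars (of_int c) = {}"
  by (simp add: vars_def flip: single_of_int)

lemma vars_prod_subset:
  assumes "\<And>x. x \<in> A \<Longrightarrow> vars (f x) \<subseteq> V"
  shows "vars (prod f A) \<subseteq> V"
  using assms
proof (induction A rule: infinite_finite_induct)
  case (insert x A)
  have "vars (f x) \<union> vars (prod f A) \<subseteq> V"
    using insert by simp
  with vars_mult[of "f x" "prod f A"] insert.hyps show ?case
    by simp blast
qed simp_all

lemma vars_sum_subset:
  assumes "\<And>x. x \<in> A \<Longrightarrow> vars (f x) \<subseteq> V"
  shows "vars (sum f A) \<subseteq> V"
  using assms
proof (induction A rule: infinite_finite_induct)
  case (insert x A)
  have "vars (f x) \<union> vars (sum f A) \<subseteq> V"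
    using insert by simp
  with vars_add[of "f x" "sum f A"] insert.hyps show ?case
    by simp blast
qed (simp_all add: vars_def)

lemma vars_mpoly_eval:
  assumes "\<And>v. vars (\<kappa> v) \<subseteq> V"
  shows "vars (mpoly_eval \<kappa> p) \<subseteq> V"
proof -
  have "vars (\<kappa> v ^ n) \<subseteq> V" for v n
    using vars_prod_subset[of "{..<n}" "\<lambda>_. \<kappa> v" V] assms[of v] by simp
  hence "vars (\<Prod>v\<in>A. \<kappa> v ^ k v) \<subseteq> V" for A and k :: "_ \<Rightarrow> nat"
    by (intro vars_prod_subset)
  hence "vars (of_int c * (\<Prod>v\<in>A. \<kappa> v ^ k v)) \<subseteq> V" for c A and k :: "_ \<Rightarrow> nat"
    using vars_mult[of "of_int c" "\<Prod>v\<in>A. \<kappa> v ^ k v"] by (simp add: subset_trans)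
  thus ?thesis
    unfolding mpoly_eval_def by (intro vars_sum_subset)
qed

section \<open>Power sums of a power series\<close>

text \<open>For \<open>f = (\<Prod>i. 1 - x\<^sub>i z)\<close> the \<open>n\<close>-th coefficient of \<open>psum f\<close> is the power sum \<open>\<Sum>i. x\<^sub>i\<^sup>n\<close>.\<close>
definition psum :: "complex fps \<Rightarrow> complex fps" where
  "psum f = - (fps_X * fps_deriv f * inverse f)"

text \<open>Since \<open>f\<close> is a unit, z f' = -P f determines P; verifying this equation
  avoids computing \<open>inverse f\<close>.\<close>

lemma psum_eqI:
  assumes "fps_nth f 0 = 1" "fps_X * fps_deriv f = - (P * f)"
  shows "psum f = P"
proof -
  have "f * inverse f = 1"
    using assms(1) by (subst mult.commute) (intro inverse_mult_eq_1, simp)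
  thus ?thesis
    by (simp add: psum_def assms(2) mult.assoc)
qed

lemma psum_rec:
  assumes "fps_nth f 0 = 1"
  shows "fps_X * fps_deriv f = - (psum f * f)"
proof -
  have "inverse f * f = 1"
    using assms by (intro inverse_mult_eq_1) simp
  thus ?thesis
    by (simp add: psum_def mult.assoc)
qed

lemma psum_newton:
  assumes "fps_nth f 0 = 1"
  shows "of_nat n * fps_nth f n = - (\<Sum>k=0..n. fps_nth (psum f) k * fps_nth f (n - k))"
proof -
  have "of_nat n * fps_nth f n = fps_nth (fps_X * fps_deriv f) n"
    by (cases n) (simp_all add: fps_X_mult_nth)
  thus ?thesis
    by (simp add: psum_rec[OF assms] fps_mult_nth)
qed

lemma psum_nth_0 [simp]: "fps_nth (psum f) 0 = 0"
  by (simp add: psum_def)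

lemma psum_mult:
  assumes "fps_nth f 0 = 1" "fps_nth g 0 = 1"
  shows "psum (f * g) = psum f + psum g"
proof (rule psum_eqI)
  have "fps_X * fps_deriv (f * g) = (fps_X * fps_deriv f) * g + f * (fps_X * fps_deriv g)"
    by (simp add: algebra_simps)
  thus "fps_X * fps_deriv (f * g) = - ((psum f + psum g) * (f * g))"
    by (simp add: psum_rec assms algebra_simps)
qed (simp add: assms)

lemma psum_1 [simp]: "psum 1 = 0"
  by (simp add: psum_def)

lemma psum_prod:
  assumes "\<And>x. x \<in> A \<Longrightarrow> fps_nth (f x) 0 = 1"
  shows "psum (prod f A) = (\<Sum>x\<in>A. psum (f x))" "fps_nth (prod f A) 0 = 1"
  using assms by (induction A rule: infinite_finite_induct) (simp_all add: psum_mult)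

lemma psum_power:
  assumes "fps_nth f 0 = 1"
  shows "psum (f ^ n) = of_nat n * psum f"
  using psum_prod(1)[of "{..<n}" "\<lambda>_. f"] assms by simp

text \<open>The geometric series of k a z^k / (1 - a z^k), which is -z times the logarithmic
  derivative of 1 - a z^k. Multiplying by 1 - a z^k telescopes it to k a z^k.\<close>

lemma psum_binomial:
  assumes "k > 0"
  shows "psum (1 - fps_const a * fps_X ^ k) =
           Abs_fps (\<lambda>n. if n > 0 \<and> k dvd n then of_nat k * a ^ (n div k) else 0)" (is "_ = ?P")
proof (rule psum_eqI)
  have "?P * (1 - fps_const a * fps_X ^ k) = fps_const (of_nat k * a) * fps_X ^ k"
  proof (rule fps_ext)
    fix n
    have lhs: "fps_nth (?P * (1 - fps_const a * fps_X ^ k)) n =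
            fps_nth ?P n - (if n < k then 0 else a * fps_nth ?P (n - k))"
      by (simp add: right_diff_distrib mult.left_commute[of ?P] fps_X_power_mult_right_nth
               flip: mult.assoc)
    consider "n < k" | "n = k" | "n > k"
      by linarith
    thus "fps_nth (?P * (1 - fps_const a * fps_X ^ k)) n = fps_nth (fps_const (of_nat k * a) * fps_X ^ k) n"
    proof cases
      case 1
      thus ?thesis
        unfolding lhs by (auto dest: dvd_imp_le)
    next
      case 2
      thus ?thesis
        unfolding lhs using assms by simp
    next
      case 3
      hence "n = (n - k) + k" "n - k > 0"
        by simp_all
      then obtain m where "n = m + k" "m > 0"
        by blast
      thus ?thesis
        unfolding lhs using assms 3 by simp
    qed
  qed
  moreover have "fps_X * fps_deriv (1 - fps_const a * fps_X ^ k) = - (fps_const (of_nat k * a) * fps_X ^ k)"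
    using assms by (intro fps_ext) (auto simp: fps_X_mult_nth)
  ultimately show "fps_X * fps_deriv (1 - fps_const a * fps_X ^ k) = - (?P * (1 - fps_const a * fps_X ^ k))"
    by simp
qed (use assms in simp)

text \<open>Newton's identity at n gives P_n from earlier power sums and the coefficients up to n,
  so truncating a series at degree N does not affect P_n for n at most N.\<close>

lemma psum_cong:
  assumes "fps_nth f 0 = 1" "fps_nth g 0 = 1" "\<And>n. n \<le> N \<Longrightarrow> fps_nth f n = fps_nth g n"
  shows "n \<le> N \<Longrightarrow> fps_nth (psum f) n = fps_nth (psum g) n"
proof (induction n rule: less_induct)
  case (less n)
  have *: "fps_nth (psum h) n = - (of_nat n * fps_nth h n) - (\<Sum>k<n. fps_nth (psum h) k * fps_nth h (n - k))"
    if "fps_nth h 0 = 1" for h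
    using psum_newton[OF that, of n] that
    by (simp add: atLeast0AtMost flip: lessThan_Suc_atMost)
  show ?case
    using less assms by (simp add: *)
qed

lemma psum_inj:
  assumes "fps_nth f 0 = 1" "fps_nth g 0 = 1" "\<And>n. n \<le> N \<Longrightarrow> fps_nth (psum f) n = fps_nth (psum g) n"
  shows "n \<le> N \<Longrightarrow> fps_nth f n = fps_nth g n"
proof (induction n rule: less_induct)
  case (less n)
  \<comment> \<open>The term k = 0 drops out because P_0 = 0, so only coefficients below n remain on
    the right. The step below then divides by n, which is where characteristic 0 enters.\<close>
  have *: "of_nat n * fps_nth h n = - (\<Sum>k\<in>{1..n}. fps_nth (psum h) k * fps_nth h (n - k))"
    if "fps_nth h 0 = 1" for h
    unfolding psum_newton[OF that] by (simp add: sum.atLeast_Suc_atMost)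
  show ?case
  proof (cases "n = 0")
    case False
    have "of_nat n * fps_nth f n = of_nat n * fps_nth g n"
      using less assms by (simp add: * )
    with False show ?thesis
      by simp
  qed (simp add: assms)
qed

section \<open>Witt coordinates\<close>

definition fps_map :: "('a::zero \<Rightarrow> 'b::zero) \<Rightarrow> 'a fps \<Rightarrow> 'b fps" where
  "fps_map h f = Abs_fps (\<lambda>n. h (fps_nth f n))"

lemma fps_map_nth [simp]: "fps_nth (fps_map h f) n = h (fps_nth f n)"
  by (simp add: fps_map_def)

text \<open>
  Every power series with constant coefficient \<open>1\<close> is uniquely \<open>\<Prod>k\<ge>1. 1 - a\<^sub>k z\<^sup>k\<close>, and the \<open>a\<^sub>k\<close> are
  integer polynomials in its coefficients: \<open>witt f k\<close> is \<open>a\<^sub>k\<close>, \<open>witt_prod f n\<close> the product of the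
  first \<open>n\<close> factors.
\<close>
primrec witt_prod :: "'a::comm_ring_1 fps \<Rightarrow> nat \<Rightarrow> 'a fps" where
  "witt_prod f 0 = 1"
| "witt_prod f (Suc n) = witt_prod f n *
     (1 - fps_const (fps_nth (witt_prod f n) (Suc n) - fps_nth f (Suc n)) * fps_X ^ Suc n)"

definition witt :: "'a::comm_ring_1 fps \<Rightarrow> nat \<Rightarrow> 'a" where
  "witt f n = fps_nth (witt_prod f (n - 1)) n - fps_nth f n"

lemma witt_prod_eq: "witt_prod f n = (\<Prod>k=1..n. 1 - fps_const (witt f k) * fps_X ^ k)"
  by (induction n) (simp_all add: witt_def)

lemma fps_mult_one_minus_nth:
  fixes f :: "'a::comm_ring_1 fps"
  shows "fps_nth (f * (1 - fps_const a * fps_X ^ k)) n =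
           fps_nth f n - (if n < k then 0 else a * fps_nth f (n - k))"
  by (simp add: right_diff_distrib mult.left_commute[of f] fps_X_power_mult_right_nth flip: mult.assoc)

text \<open>Multiplication by 1 - c z^(n+1) leaves the coefficients up to n alone and lowers the
  next one by c, as the constant coefficient is 1; c is the excess to be removed there.\<close>

lemma witt_prod_nth:
  assumes "fps_nth f 0 = 1"
  shows "k \<le> n \<Longrightarrow> fps_nth (witt_prod f n) k = fps_nth f k"
proof (induction n arbitrary: k)
  case (Suc n)
  have "fps_nth (witt_prod f n) 0 = 1"
    using Suc.IH[of 0] assms by simp
  thus ?case
    using Suc assms unfolding witt_prod.simps fps_mult_one_minus_nth
    by (cases "k = Suc n") simp_all
qed (use assms in simp)

text \<open>
  The factors come from
  \<open>(1 - a z\<^sup>k) \<star> (1 - b z\<^sup>l) = (1 - a\<^bsup>l/d\<^esup> b\<^bsup>k/d\<^esup> z\<^bsup>lcm k l\<^esup>)\<^sup>d\<close> with \<open>d = gcd k l\<close>.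
\<close>
definition ene_trunc :: "nat \<Rightarrow> 'a::comm_ring_1 fps \<Rightarrow> 'a fps \<Rightarrow> 'a fps" where
  "ene_trunc N f g = (\<Prod>(k, l)\<in>{1..N} \<times> {1..N}.
     (1 - fps_const (witt f k ^ (l div gcd k l) * witt g l ^ (k div gcd k l)) * fps_X ^ lcm k l) ^ gcd k l)"

context ring_hom_cr
begin

lemma ring_hom_cr_fps_map: "ring_hom_cr (fps_map h)"
  by unfold_locales (auto simp: fps_eq_iff fps_mult_nth hom_add hom_sum hom_mult fps_one_nth)

lemma fps_map_binomial:
  "fps_map h (1 - fps_const a * fps_X ^ k) = 1 - fps_const (h a) * fps_X ^ k"
  by (auto simp: fps_eq_iff fps_one_nth hom_diff fps_X_power_iff)

lemma fps_map_witt_prod: "fps_map h (witt_prod f n) = witt_prod (fps_map h f) n"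
proof -
  interpret M: ring_hom_cr "fps_map h"
    by (rule ring_hom_cr_fps_map)
  show ?thesis
  proof (induction n)
    case (Suc n)
    have "h (fps_nth (witt_prod f n) k) = fps_nth (witt_prod (fps_map h f) n) k" for k
      by (simp flip: Suc.IH)
    thus ?case
      by (simp only: witt_prod.simps M.hom_mult fps_map_binomial hom_diff Suc.IH fps_map_nth)
  qed simp
qed

lemma hom_witt: "h (witt f n) = witt (fps_map h f) n"
  by (simp add: witt_def hom_diff flip: fps_map_witt_prod)

text \<open>Only ring operations enter \<open>witt\<close> and \<open>ene_trunc\<close>; hence
  evaluating the construction over Z[X, Y] at a point gives the same construction over the complex
  numbers.\<close>

lemma fps_map_ene_trunc: "fps_map h (ene_trunc N f g) = ene_trunc N (fps_map h f) (fps_map h g)"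
proof -
  interpret M: ring_hom_cr "fps_map h"
    by (rule ring_hom_cr_fps_map)
  show ?thesis
    by (simp add: ene_trunc_def M.hom_prod M.hom_power fps_map_binomial case_prod_unfold
          hom_mult hom_power hom_witt)
qed

end

text \<open>Factors of index above N change no coefficient up to N. Summing over
  \<open>{1..N}\<close> instead of the divisors of n gives one index range for all n, ready to be
  multiplied out.\<close>

lemma psum_witt:
  assumes "fps_nth f 0 = 1" "n \<in> {1..N}"
  shows "fps_nth (psum f) n = (\<Sum>k\<in>{1..N}. if k dvd n then of_nat k * witt f k ^ (n div k) else 0)"
proof -
  have w0: "fps_nth (witt_prod f N) 0 = 1"
    using witt_prod_nth[OF assms(1), of 0 N] assms(1) by simp
  have "fps_nth (psum f) n = fps_nth (psum (witt_prod f N)) n"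
    by (rule psum_cong[where N = N]) (use w0 assms witt_prod_nth[OF assms(1)] in auto)
  also have "psum (witt_prod f N) = (\<Sum>k\<in>{1..N}. psum (1 - fps_const (witt f k) * fps_X ^ k))"
    unfolding witt_prod_eq by (rule psum_prod) simp
  also have "fps_nth \<dots> n = (\<Sum>k\<in>{1..N}. if k dvd n then of_nat k * witt f k ^ (n div k) else 0)"
    unfolding fps_sum_nth by (rule sum.cong) (use assms in \<open>auto simp: psum_binomial\<close>)
  finally show ?thesis .
qed

text \<open>Power sums are additive over the factors, which leaves one pair (k, l) with d = gcd k l.
  Both sides vanish unless lcm k l divides n; then d * lcm k l = k * l matches the constants, and n
  / k = (l / d) * (n / lcm k l), with its mirror image for l, matches the exponents.\<close>

lemma psum_ene_trunc:
  assumes "fps_nth f 0 = 1" "fps_nth g 0 = 1" "n \<in> {1..N}"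
  shows "fps_nth (psum (ene_trunc N f g)) n = fps_nth (psum f) n * fps_nth (psum g) n"
    and "fps_nth (ene_trunc N f g) 0 = 1"
proof -
  let ?b = "\<lambda>(k, l). 1 - fps_const (witt f k ^ (l div gcd k l) * witt g l ^ (k div gcd k l)) * fps_X ^ lcm k l"
  have b0: "fps_nth (?b x ^ m) 0 = 1" if "x \<in> {1..N} \<times> {1..N}" for x m
  proof -
    obtain k l where "x = (k, l)" "k > 0" "l > 0"
      using \<open>x \<in> _\<close> by auto
    moreover from this have "lcm k l \<noteq> 0"
      by simp
    ultimately show ?thesis
      by (simp add: fps_nth_power_0 power_0_left)
  qed
  have eq: "ene_trunc N f g = (\<Prod>x\<in>{1..N} \<times> {1..N}. ?b x ^ gcd (fst x) (snd x))"
    by (simp add: ene_trunc_def case_prod_unfold)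
  show "fps_nth (ene_trunc N f g) 0 = 1"
    unfolding eq by (rule psum_prod(2)) (rule b0)
  have "psum (ene_trunc N f g) = (\<Sum>x\<in>{1..N} \<times> {1..N}. psum (?b x ^ gcd (fst x) (snd x)))"
    unfolding eq by (rule psum_prod(1)) (rule b0)
  also have "\<dots> = (\<Sum>x\<in>{1..N} \<times> {1..N}. of_nat (gcd (fst x) (snd x)) * psum (?b x))"
    by (rule sum.cong[OF refl], rule psum_power) (use b0[of _ 1] in simp)
  finally have "fps_nth (psum (ene_trunc N f g)) n =
      fps_nth (\<Sum>x\<in>{1..N} \<times> {1..N}. of_nat (gcd (fst x) (snd x)) * psum (?b x)) n"
    by (rule arg_cong)
  also have "\<dots> = (\<Sum>x\<in>{1..N} \<times> {1..N}.
      (if fst x dvd n then of_nat (fst x) * witt f (fst x) ^ (n div fst x) else 0) *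
      (if snd x dvd n then of_nat (snd x) * witt g (snd x) ^ (n div snd x) else 0))"
    unfolding fps_sum_nth
  proof (rule sum.cong[OF refl])
    fix x assume "x \<in> {1..N} \<times> {1..N}"
    then obtain k l where x: "x = (k, l)" "k > 0" "l > 0"
      by auto
    define d where "d = gcd k l"
    have lcm_gcd: "lcm k l * d = k * l"
      unfolding d_def by (simp add: mult.commute flip: prod_gcd_lcm_nat)
    have "d > 0" "d dvd k" "d dvd l"
      using x by (auto simp: d_def)
    have *: "fps_nth (of_nat d * psum (?b x)) n =
      of_nat d * (if lcm k l dvd n then of_nat (lcm k l) *
        (witt f k ^ (l div d) * witt g l ^ (k div d)) ^ (n div lcm k l) else 0)"
      using x assms(3) by (simp add: psum_binomial lcm_pos_nat d_def fps_mult_of_nat_nth)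
    show "fps_nth (of_nat (gcd (fst x) (snd x)) * psum (?b x)) n =
      (if fst x dvd n then of_nat (fst x) * witt f (fst x) ^ (n div fst x) else 0) *
      (if snd x dvd n then of_nat (snd x) * witt g (snd x) ^ (n div snd x) else 0)"
    proof (cases "k dvd n \<and> l dvd n")
      case True
      hence "lcm k l dvd n"
        by simp
      then obtain m where n: "n = lcm k l * m"
        by blast
      have nk: "n div k = l div d * m"
      proof -
        have "lcm k l = k * (l div d)"
          using lcm_gcd \<open>d dvd l\<close> \<open>d > 0\<close> by (metis dvd_div_mult2_eq dvd_triv_right mult.commute div_mult_swap nonzero_mult_div_cancel_right not_gr_zero)
        thus ?thesis
          using x by (simp add: n mult.assoc)
      qed
      have nl: "n div l = k div d * m"
      proof -
        have "lcm k l = l * (k div d)"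
          using lcm_gcd \<open>d dvd k\<close> \<open>d > 0\<close> by (metis dvd_div_mult2_eq dvd_triv_right mult.commute div_mult_swap nonzero_mult_div_cancel_right not_gr_zero)
        thus ?thesis
          using x by (simp add: n mult.assoc)
      qed
      have gl: "of_nat d * of_nat (lcm k l) = (of_nat k * of_nat l :: complex)"
        using lcm_gcd by (metis mult.commute of_nat_mult)
      have nm: "n div lcm k l = m"
        using x by (simp add: n)
      let ?A = "witt f k" and ?B = "witt g l"
      have "fps_nth (of_nat d * psum (?b x)) n =
              of_nat d * (of_nat (lcm k l) * (?A ^ (l div d) * ?B ^ (k div d)) ^ m)"
        unfolding * if_P[OF \<open>lcm k l dvd n\<close>] nm ..
      also have "\<dots> = (of_nat d * of_nat (lcm k l)) * (?A ^ (n div k) * ?B ^ (n div l))"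
        by (simp only: nk nl power_mult power_mult_distrib mult.assoc)
      also have "\<dots> = (of_nat k * ?A ^ (n div k)) * (of_nat l * ?B ^ (n div l))"
        unfolding gl by (rule mult.assoc[THEN trans], subst mult.left_commute[of "of_nat l"]) (rule mult.assoc[symmetric])
      finally show ?thesis
        using True unfolding x d_def fst_conv snd_conv by (simp only: simp_thms if_True)
    next
      case False
      thus ?thesis
        using * by (auto simp: x d_def)
    qed
  qed
  also have "\<dots> = fps_nth (psum f) n * fps_nth (psum g) n"
    unfolding psum_witt[OF assms(1,3)] psum_witt[OF assms(2,3)]
    by (simp only: sum_product sum.cartesian_product case_prod_unfold)
  finally show "fps_nth (psum (ene_trunc N f g)) n = fps_nth (psum f) n * fps_nth (psum g) n" .
qed

text \<open>\<open>h\<close> is any series with the right power sums: a finite product over pairs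
  when Q_n is verified, an arbitrary candidate in \<open>ene_prod_eqI\<close>.\<close>

lemma ene_trunc_nth:
  assumes "fps_nth f 0 = 1" "fps_nth g 0 = 1" "fps_nth h 0 = 1"
    and "\<And>n. n \<in> {1..N} \<Longrightarrow> fps_nth (psum h) n = fps_nth (psum f) n * fps_nth (psum g) n"
  shows "fps_nth (ene_trunc N f g) N = fps_nth h N"
proof (cases "N = 0")
  case True
  thus ?thesis
    using assms(3) by (simp add: ene_trunc_def)
next
  case False
  have "fps_nth (psum (ene_trunc N f g)) n = fps_nth (psum h) n" if "n \<le> N" for n
  proof (cases "n = 0")
    case False
    with that have n: "n \<in> {1..N}"
      by simp
    show ?thesis
      by (simp only: psum_ene_trunc(1)[OF assms(1,2) n] assms(4)[OF n])
  qed simp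
  moreover from False have "fps_nth (ene_trunc N f g) 0 = 1"
    by (intro psum_ene_trunc(2)[OF assms(1,2), of N N]) simp
  ultimately show ?thesis
    using assms(3) by (intro psum_inj[where N = N and n = N]) simp_all
qed

section \<open>Existence and uniqueness of the polynomials \<open>Q\<^sub>n\<close>\<close>

text \<open>The generic series are cut at degree n so that only the first n variables of each kind
  occur; the sign undoes the factor (-1)^n in the definition of \<open>ene_prod\<close>.\<close>

definition ene_witness :: "nat \<Rightarrow> (nat + nat) int_mpoly" where
  "ene_witness n = (-1) ^ n * fps_nth (ene_trunc n
     (Abs_fps (\<lambda>k. if k = 0 then 1 else if k \<le> n then Var (Inl k) else 0))
     (Abs_fps (\<lambda>k. if k = 0 then 1 else if k \<le> n then Var (Inr k) else 0))) n"

lemma (in ring_hom_cr) fps_map_Abs_fps_if: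
  "fps_map h (Abs_fps (\<lambda>k. if k = 0 then 1 else if k \<le> n then c k else 0)) =
   Abs_fps (\<lambda>k. if k = 0 then 1 else if k \<le> n then h (c k) else 0)"
  by (simp add: fps_eq_iff)

lemma mpoly_eval_ene_witness:
  "mpoly_eval \<phi> (ene_witness n) = (-1) ^ n * fps_nth (ene_trunc n
     (Abs_fps (\<lambda>k. if k = 0 then 1 else if k \<le> n then \<phi> (Inl k) else 0))
     (Abs_fps (\<lambda>k. if k = 0 then 1 else if k \<le> n then \<phi> (Inr k) else 0))) n"
proof -
  interpret ring_hom_cr "mpoly_eval \<phi>"
    by (rule ring_hom_cr_mpoly_eval)
  show ?thesis
    unfolding ene_witness_def hom_mult hom_power hom_uminus hom_1
    by (simp only: fps_map_ene_trunc fps_map_Abs_fps_if mpoly_eval_Var flip: fps_map_nth)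
qed

text \<open>Setting all variables outside the allowed set to 0 leaves \<open>ene_witness\<close>
  unchanged, and the result of a substitution involves only variables of the substituted
  polynomials.\<close>

lemma vars_ene_witness: "vars (ene_witness n) \<subseteq> Inl ` {1..n} \<union> Inr ` {1..n}" (is "_ \<subseteq> ?V")
proof -
  define \<kappa> :: "nat + nat \<Rightarrow> (nat + nat) int_mpoly" where "\<kappa> = (\<lambda>v. if v \<in> ?V then Var v else 0)"
  have \<kappa>: "\<kappa> (Inl k) = Var (Inl k)" "\<kappa> (Inr k) = Var (Inr k)" if "k \<noteq> 0" "k \<le> n" for k
    using that by (auto simp: \<kappa>_def)
  have "mpoly_eval \<kappa> (ene_witness n) = ene_witness n"
    unfolding mpoly_eval_ene_witness unfolding ene_witness_def
    by (intro arg_cong2[of _ _ _ _ "(*)"] arg_cong2[of _ _ _ _ fps_nth]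
        arg_cong2[of _ _ _ _ "ene_trunc n"] refl arg_cong[of _ _ Abs_fps] ext) (simp_all add: \<kappa>)
  moreover have "vars (\<kappa> v) \<subseteq> ?V" for v
    by (auto simp: \<kappa>_def Var_def vars_def split: if_splits)
  ultimately show ?thesis
    using vars_mpoly_eval[of \<kappa> ?V "ene_witness n"] by simp
qed

section \<open>Elementary symmetric polynomials and their generating function\<close>

lemma prod_one_plus_eq_esym:
  fixes x :: "'i \<Rightarrow> 'a::comm_ring_1"
  assumes "finite A"
  shows "(\<Prod>i\<in>A. 1 + fps_const (x i) * fps_X) = Abs_fps (\<lambda>k. esym k A x)"
proof (rule fps_ext)
  fix k
  have const: "(\<Prod>i\<in>S. fps_const (x i)) = fps_const (\<Prod>i\<in>S. x i)" for S
    by (induction S rule: infinite_finite_induct) simp_all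
  have "(\<Prod>i\<in>A. 1 + fps_const (x i) * fps_X) = (\<Prod>i\<in>A. fps_const (x i) * fps_X + 1)"
    by (simp add: add.commute)
  also have "\<dots> = (\<Sum>S\<in>Pow A. fps_const (\<Prod>i\<in>S. x i) * fps_X ^ card S)"
    by (subst prod_add[OF assms])
       (simp add: prod.distrib const)
  also have "fps_nth \<dots> k = (\<Sum>S\<in>Pow A. if card S = k then \<Prod>i\<in>S. x i else 0)"
    unfolding fps_sum_nth by (intro sum.cong) (auto simp: fps_X_power_iff)
  also have "\<dots> = esym k A x"
    unfolding esym_def using assms by (intro sum.mono_neutral_cong_right) auto
  finally show "fps_nth (\<Prod>i\<in>A. 1 + fps_const (x i) * fps_X) k = fps_nth (Abs_fps (\<lambda>k. esym k A x)) k"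
    by simp
qed

lemma esym_0 [simp]: "finite A \<Longrightarrow> esym 0 A x = 1"
proof -
  assume "finite A"
  hence "{S. S \<subseteq> A \<and> card S = 0} = {{}}"
    by (auto dest: finite_subset)
  thus ?thesis
    by (simp add: esym_def)
qed

lemma esym_eq_0:
  assumes "finite A" "card A < k"
  shows "esym k A x = 0"
proof -
  have "{S. S \<subseteq> A \<and> card S = k} = {}"
    using assms card_mono[OF assms(1)] by (auto simp: not_less[symmetric])
  thus ?thesis
    by (simp only: esym_def sum.empty)
qed

text \<open>The sign comes from the generating function of \<open>esym\<close>: its factors are 1 +
  x z, while \<open>psum\<close> reads off x from a factor 1 - x z.\<close>

lemma psum_prod_one_plus:
  assumes "finite A" "n > 0"
  shows "fps_nth (psum (\<Prod>i\<in>A. 1 + fps_const (x i) * fps_X)) n = (\<Sum>i\<in>A. (- x i) ^ n)"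
proof -
  have "psum (\<Prod>i\<in>A. 1 + fps_const (x i) * fps_X) = (\<Sum>i\<in>A. psum (1 + fps_const (x i) * fps_X))"
    by (rule psum_prod) simp
  also have "\<dots> = (\<Sum>i\<in>A. psum (1 - fps_const (- x i) * fps_X ^ 1))"
    by (simp flip: fps_const_neg)
  also have "fps_nth \<dots> n = (\<Sum>i\<in>A. (- x i) ^ n)"
    unfolding fps_sum_nth by (subst psum_binomial) (use assms in auto)
  finally show ?thesis .
qed

text \<open>At a complex point the generic series become the products of the 1 + x_i z and of the 1
  + y_j z, and power sums identify the n-th coefficient of \<open>ene_trunc\<close>. The sign (-1)^n
  of \<open>ene_witness\<close> cancels against the one in e_n of the -x_i y_j.\<close>

lemma is_ene_poly_ene_witness: "is_ene_poly n (ene_witness n)"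
proof -
  let ?e = "case_sum (\<lambda>k. esym k {1..n} (\<lambda>i. Var (Inl i)))
              (\<lambda>k. esym k {1..n} (\<lambda>j. Var (Inr j))) :: nat + nat \<Rightarrow> (nat + nat) int_mpoly"
  have "esym n ({1..n} \<times> {1..n}) (\<lambda>(i, j). Var (Inl i) * Var (Inr j)) = mpoly_eval ?e (ene_witness n)"
  proof (rule int_mpoly_eqI_eval)
    fix \<phi> :: "nat + nat \<Rightarrow> complex"
    interpret ring_hom_cr "mpoly_eval \<phi>"
      by (rule ring_hom_cr_mpoly_eval)
    define x y where "x = (\<lambda>i. \<phi> (Inl i))" and "y = (\<lambda>i. \<phi> (Inr i))"
    \<comment> \<open>Cutting at degree n loses nothing: e_k of n elements is 0 for k > n.\<close>
    have trunc: "Abs_fps (\<lambda>k. if k = 0 then 1 else if k \<le> n then esym k {1..n} u else 0) =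
                 (\<Prod>i\<in>{1..n}. 1 + fps_const (u i) * fps_X)" for u :: "nat \<Rightarrow> complex"
      by (subst prod_one_plus_eq_esym) (auto simp: fps_eq_iff esym_eq_0)
    have const: "fps_nth (\<Prod>i\<in>A. 1 + fps_const (u i) * fps_X) 0 = 1" for A and u :: "'b \<Rightarrow> complex"
      by (rule psum_prod(2)) simp
    let ?f = "\<Prod>i\<in>{1..n}. 1 + fps_const (x i) * fps_X"
    let ?g = "\<Prod>i\<in>{1..n}. 1 + fps_const (y i) * fps_X"
    \<comment> \<open>The factors 1 + x_i z and 1 + y_j z belong to -x_i and -y_j, whose product x_i
      y_j belongs to the factor 1 - x_i y_j z.\<close>
    let ?h = "\<Prod>p\<in>{1..n}\<times>{1..n}. 1 + fps_const (- (x (fst p) * y (snd p))) * fps_X"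
    have lhs: "mpoly_eval \<phi> (mpoly_eval ?e (ene_witness n)) = (-1) ^ n * fps_nth (ene_trunc n ?f ?g) n"
      unfolding hom_mpoly_eval unfolding mpoly_eval_ene_witness trunc[symmetric]
      by (simp only: sum.case hom_esym mpoly_eval_Var x_def y_def)
    have trunc_nth: "fps_nth (ene_trunc n ?f ?g) n = fps_nth ?h n"
    proof (rule ene_trunc_nth)
      fix m assume "m \<in> {1..n}"
      hence "m > 0"
        by simp
      thus "fps_nth (psum ?h) m = fps_nth (psum ?f) m * fps_nth (psum ?g) m"
        by (simp only: psum_prod_one_plus finite_cartesian_product finite_atLeastAtMost)
           (simp only: sum_product sum.cartesian_product case_prod_unfold minus_minus mult_minus_left
              mult_minus_right flip: power_mult_distrib)
    qed (rule const)+
    have "fps_nth ?h n = esym n ({1..n} \<times> {1..n}) (\<lambda>p. - (x (fst p) * y (snd p)))"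
      by (simp only: prod_one_plus_eq_esym finite_cartesian_product finite_atLeastAtMost fps_nth_Abs_fps)
    also have "\<dots> = (-1) ^ n * esym n ({1..n} \<times> {1..n}) (\<lambda>p. x (fst p) * y (snd p))"
      unfolding esym_def sum_distrib_left by (rule sum.cong[OF refl]) (simp only: mem_Collect_eq prod_uminus)
    finally have "mpoly_eval \<phi> (mpoly_eval ?e (ene_witness n)) =
        (-1) ^ n * ((-1) ^ n * esym n ({1..n} \<times> {1..n}) (\<lambda>p. x (fst p) * y (snd p)))"
      by (simp only: lhs trunc_nth)
    also have "\<dots> = esym n ({1..n} \<times> {1..n}) (\<lambda>p. x (fst p) * y (snd p))"
      by (simp only: mult.assoc[symmetric] minus_one_mult_self mult_1_left)
    also have "\<dots> = mpoly_eval \<phi> (esym n ({1..n} \<times> {1..n}) (\<lambda>(i, j). Var (Inl i) * Var (Inr j)))"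
      by (simp only: hom_esym hom_mult mpoly_eval_Var x_def y_def case_prod_unfold)
    finally show "mpoly_eval \<phi> (esym n ({1..n} \<times> {1..n}) (\<lambda>(i, j). Var (Inl i) * Var (Inr j))) =
                  mpoly_eval \<phi> (mpoly_eval ?e (ene_witness n))"
      by (rule sym)
  qed
  with vars_ene_witness show ?thesis
    unfolding is_ene_poly_def by (rule conjI)
qed

text \<open>Vieta: the monic polynomial with coefficient \<open>a k\<close> at degree
  \<open>n - k\<close> splits over the complex numbers, and its negated roots serve as
  \<open>x\<close>.\<close>

lemma esym_surj:
  fixes a :: "nat \<Rightarrow> complex"
  obtains x where "\<And>k. k \<in> {1..n} \<Longrightarrow> esym k {1..n} x = a k"
proof -
  define p where "p = Polynomial.monom 1 n + (\<Sum>k<n. Polynomial.monom (a (n - k)) k)"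
  have coeff_p: "coeff p k = (if k = n then 1 else if k < n then a (n - k) else 0)" for k
  proof -
    have "coeff p k = (if n = k then 1 else 0) + (\<Sum>j<n. if j = k then a (n - j) else 0)"
      by (simp add: p_def coeff_sum)
    also have "(\<Sum>j<n. if j = k then a (n - j) else 0) = (if k < n then a (n - k) else 0)"
      by (subst sum.delta) simp_all
    finally show ?thesis
      by auto
  qed
  have "Polynomial.degree p = n"
    by (rule antisym[OF degree_le le_degree]) (auto simp: coeff_p)
  moreover have "p \<noteq> 0"
    using coeff_p[of n] by auto
  ultimately obtain M where M: "size M = n" "p = (\<Prod>x\<in>#M. [:- x, 1:])"
    using alg_closed_imp_factorization[of p] coeff_p[of n] by auto
  obtain xs where "M = mset xs"
    by (metis ex_mset)
  hence "p = prod_list (map (\<lambda>x. [:- x, 1:]) xs)" "length xs = n"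
    using M by (simp_all flip: mset_map prod_mset_prod_list)
  hence p: "p = (\<Prod>i<n. [:- (xs ! i), 1:])"
    by (simp add: prod.list_conv_set_nth atLeast0LessThan)
  \<comment> \<open>With negated roots the linear factors are X + x_i, so Vieta's formulas carry no
    signs; the shift passes from list positions starting at 0 to the index set
    \<open>{1..n}\<close>.\<close>
  define x where "x = (\<lambda>i. - (xs ! (i - 1)))"
  have p': "p = (\<Prod>i\<in>{1..n}. [:x i, 1:])"
    unfolding p x_def by (rule prod.reindex_bij_witness[of _ "\<lambda>i. i - 1" Suc]) auto
  have "p = (\<Sum>S\<in>Pow {1..n}. Polynomial.monom (\<Prod>i\<in>S. x i) (n - card S))"
  proof -
    have "[:x i, 1:] = [:x i:] + Polynomial.monom 1 1" for i
      by (simp add: monom_altdef)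
    hence "p = (\<Sum>S\<in>Pow {1..n}. (\<Prod>i\<in>S. [:x i:]) * (\<Prod>i\<in>{1..n} - S. Polynomial.monom 1 1))"
      unfolding p' by (simp add: prod_add)
    also have "\<dots> = (\<Sum>S\<in>Pow {1..n}. Polynomial.monom (\<Prod>i\<in>S. x i) (n - card S))"
    proof (rule sum.cong)
      fix S assume "S \<in> Pow {1..n}"
      hence "card ({1..n} - S) = n - card S"
        by (subst card_Diff_subset) (auto dest: finite_subset)
      moreover have "(\<Prod>i\<in>S. [:x i:]) = [:\<Prod>i\<in>S. x i:]"
        by (induction S rule: infinite_finite_induct) (auto simp: one_pCons)
      ultimately show "(\<Prod>i\<in>S. [:x i:]) * (\<Prod>i\<in>{1..n} - S. Polynomial.monom 1 1) =
            Polynomial.monom (\<Prod>i\<in>S. x i) (n - card S)"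
        by (simp add: monom_power smult_monom)
    qed auto
    finally show ?thesis .
  qed
  moreover have "esym k {1..n} x = a k" if k: "k \<in> {1..n}" for k
  proof -
    have "a k = coeff p (n - k)"
      using k by (auto simp: coeff_p)
    \<comment> \<open>Truncated subtraction is harmless: \<open>card S\<close> and \<open>k\<close>
      are at most \<open>n\<close>, so the condition says \<open>card S = k\<close>.\<close>
    also have "\<dots> = (\<Sum>S\<in>Pow {1..n}. if n - card S = n - k then \<Prod>i\<in>S. x i else 0)"
      by (subst \<open>p = (\<Sum>S\<in>Pow {1..n}. _ S)\<close>) (simp add: coeff_sum)
    also have "\<dots> = esym k {1..n} x"
      unfolding esym_def
    proof (intro sum.mono_neutral_cong_right ballI)
      fix S assume "S \<in> Pow {1..n} - {S. S \<subseteq> {1..n} \<and> card S = k}"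
      moreover from this have "card S \<le> n"
        using card_mono[of "{1..n}" S] by auto
      ultimately show "(if n - card S = n - k then \<Prod>i\<in>S. x i else 0) = 0"
        using k by auto
    qed auto
    finally show ?thesis
      by simp
  qed
  ultimately show ?thesis
    using that by blast
qed

text \<open>By \<open>esym_surj\<close> all values of X_1, ..., X_n, Y_1, ..., Y_n come from some x
  and y, at which the defining identity prescribes the value of Q; and Q contains no other
  variables.\<close>

lemma ene_poly_eq: "ene_poly n = ene_witness n"
  unfolding ene_poly_def
proof (rule the_equality)
  fix Q assume Q: "is_ene_poly n Q"
  show "Q = ene_witness n"
  proof (rule int_mpoly_eqI_eval)
    fix \<phi> :: "nat + nat \<Rightarrow> complex"
    obtain x where x: "\<And>k. k \<in> {1..n} \<Longrightarrow> esym k {1..n} x = \<phi> (Inl k)"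
      using esym_surj[of n "\<lambda>k. \<phi> (Inl k)"] by blast
    obtain y where y: "\<And>k. k \<in> {1..n} \<Longrightarrow> esym k {1..n} y = \<phi> (Inr k)"
      using esym_surj[of n "\<lambda>k. \<phi> (Inr k)"] by blast
    interpret ring_hom_cr "mpoly_eval (case_sum x y)"
      by (rule ring_hom_cr_mpoly_eval)
    have "mpoly_eval \<phi> P = mpoly_eval (case_sum x y)
        (esym n ({1..n} \<times> {1..n}) (\<lambda>(i, j). Var (Inl i) * Var (Inr j)))" if "is_ene_poly n P" for P
    proof -
      from that have "vars P \<subseteq> Inl ` {1..n} \<union> Inr ` {1..n}"
        by (simp add: is_ene_poly_def)
      hence "mpoly_eval \<phi> P = mpoly_eval (\<lambda>v. mpoly_eval (case_sum x y)
          (case_sum (\<lambda>k. esym k {1..n} (\<lambda>i. Var (Inl i))) (\<lambda>k. esym k {1..n} (\<lambda>j. Var (Inr j))) v)) P"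
      proof (intro mpoly_eval_cong)
        fix v assume "v \<in> vars P"
        with \<open>vars P \<subseteq> _\<close> have "v \<in> Inl ` {1..n} \<union> Inr ` {1..n}"
          by blast
        thus "\<phi> v = mpoly_eval (case_sum x y)
            (case_sum (\<lambda>k. esym k {1..n} (\<lambda>i. Var (Inl i))) (\<lambda>k. esym k {1..n} (\<lambda>j. Var (Inr j))) v)"
          using x y by (auto simp: hom_esym)
      qed
      thus ?thesis
        using that by (simp only: is_ene_poly_def hom_mpoly_eval)
    qed
    from this[OF Q] this[OF is_ene_poly_ene_witness]
    show "mpoly_eval \<phi> Q = mpoly_eval \<phi> (ene_witness n)"
      by simp
  qed
qed (rule is_ene_poly_ene_witness)

text \<open>The n-th polynomial sees \<open>f\<close> and \<open>g\<close> cut at degree n, which by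
  \<open>psum_cong\<close> keeps the power sums up to n. A claim about \<open>\<star>\<close> thus
  becomes one about power sums.\<close>

lemma ene_prod_eqI:
  assumes "fps_nth f 0 = 1" "fps_nth g 0 = 1" "fps_nth h 0 = 1"
    and "\<And>n. fps_nth (psum h) n = fps_nth (psum f) n * fps_nth (psum g) n"
  shows "f \<star> g = h"
proof (rule fps_ext)
  fix n
  let ?t = "\<lambda>f. Abs_fps (\<lambda>k. if k = 0 then 1 else if k \<le> n then fps_nth f k else 0) :: complex fps"
  have t: "fps_nth (psum (?t f)) m = fps_nth (psum f) m" if "fps_nth f 0 = 1" "m \<le> n" for f m
    by (rule psum_cong[where N = n]) (use that in auto)
  have "fps_nth (ene_trunc n (?t f) (?t g)) n = fps_nth h n"
    by (rule ene_trunc_nth) (use assms t in simp_all)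
  thus "fps_nth (f \<star> g) n = fps_nth h n"
    using assms(3) by (simp add: ene_prod_def ene_poly_eq mpoly_eval_ene_witness cong: if_cong flip: mult.assoc power_mult_distrib)
qed

section \<open>Weierstrass factors\<close>

lemma has_fps_expansion_entire:
  "f holomorphic_on UNIV \<Longrightarrow> f has_fps_expansion fps_expansion f 0"
  by (rule has_fps_expansion_fps_expansion[of UNIV]) auto

lemma fps_expansion_mult_entire:
  assumes "f holomorphic_on UNIV" "g holomorphic_on UNIV"
  shows "fps_expansion (\<lambda>z. f z * g z) 0 = fps_expansion f 0 * fps_expansion g 0"
  by (intro fps_expansion_eqI has_fps_expansion_mult has_fps_expansion_entire assms)

lemma fps_expansion_prod_entire:
  assumes "\<And>i. i \<in> A \<Longrightarrow> f i holomorphic_on UNIV"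
  shows "fps_expansion (\<lambda>z. \<Prod>i\<in>A. f i z) 0 = (\<Prod>i\<in>A. fps_expansion (f i) 0)"
  using assms
proof (induction A rule: infinite_finite_induct)
  case (insert x A)
  thus ?case
    by (simp add: fps_expansion_mult_entire holomorphic_on_prod)
qed (auto intro!: fps_expansion_eqI)

lemma fps_expansion_nth_0 [simp]: "fps_nth (fps_expansion f 0) 0 = f 0"
  by (simp add: fps_expansion_def)

lemma has_fps_expansion_poly: "poly p has_fps_expansion fps_of_poly p" for p :: "complex poly"
  by (simp add: has_fps_expansion_def eval_fps_of_poly)

lemma psum_exp_poly:
  assumes "poly q 0 = 0"
  shows "psum (fps_expansion (\<lambda>z. exp (poly q z)) 0) = - (fps_X * fps_deriv (fps_of_poly q))"
proof (rule psum_eqI)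
  let ?e = "\<lambda>z. exp (poly q z)"
  have e: "?e has_fps_expansion fps_expansion ?e 0"
    by (intro has_fps_expansion_entire holomorphic_intros)
  have "deriv ?e = (\<lambda>z. poly (pderiv q) z * ?e z)"
    by (intro ext DERIV_imp_deriv) (auto intro!: derivative_eq_intros)
  with has_fps_expansion_deriv[OF e]
  have "(\<lambda>z. poly (pderiv q) z * ?e z) has_fps_expansion fps_deriv (fps_expansion ?e 0)"
    by simp
  moreover have "(\<lambda>z. poly (pderiv q) z * ?e z) has_fps_expansion
      fps_of_poly (pderiv q) * fps_expansion ?e 0"
    by (intro has_fps_expansion_mult has_fps_expansion_poly e)
  ultimately have "fps_deriv (fps_expansion ?e 0) = fps_deriv (fps_of_poly q) * fps_expansion ?e 0"
    by (simp add: fps_expansion_unique_complex fps_of_poly_pderiv)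
  thus "fps_X * fps_deriv (fps_expansion ?e 0) =
          - (- (fps_X * fps_deriv (fps_of_poly q)) * fps_expansion ?e 0)"
    by (simp add: mult.assoc)
qed (use assms in simp)

text \<open>The factor 1 - c z contributes c^n for every n >= 1, and the exponential of the sum of
  (c z)^k / k over 1 <= k <= \<rho> cancels exactly the terms with n <= \<rho>.\<close>

lemma psum_weierstrass_factor:
  "fps_nth (psum (fps_expansion (\<lambda>z. weierstrass_factor \<rho> (z * c)) 0)) n = (if n > \<rho> then c ^ n else 0)"
proof -
  define q where "q = (\<Sum>k=1..\<rho>. Polynomial.monom (c ^ k / of_nat k) k)"
  have coeff_q: "coeff q k = (if k \<in> {1..\<rho>} then c ^ k / of_nat k else 0)" for k
    by (simp add: q_def coeff_sum sum.delta')
  have q0: "poly q 0 = 0"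
    by (simp add: poly_0_coeff_0 coeff_q)
  let ?E = "fps_expansion (\<lambda>z. exp (poly q z)) 0"
  have eq: "(\<lambda>z. weierstrass_factor \<rho> (z * c)) = (\<lambda>z. (1 - c * z) * exp (poly q z))"
    by (intro ext) (simp add: weierstrass_factor_def q_def poly_sum poly_monom power_mult_distrib mult_ac)
  have "(\<lambda>z. (1 - c * z)) has_fps_expansion (1 - fps_const c * fps_X ^ 1)"
    by (intro fps_expansion_intros) (auto intro!: fps_expansion_intros)
  hence "(\<lambda>z. (1 - c * z) * exp (poly q z)) has_fps_expansion (1 - fps_const c * fps_X ^ 1) * ?E"
    by (intro has_fps_expansion_mult has_fps_expansion_entire holomorphic_intros)
  hence "fps_expansion (\<lambda>z. weierstrass_factor \<rho> (z * c)) 0 = (1 - fps_const c * fps_X ^ 1) * ?E"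
    unfolding eq by (rule fps_expansion_eqI)
  also have "psum \<dots> = psum (1 - fps_const c * fps_X ^ 1) + psum ?E"
    by (rule psum_mult) (simp_all add: q0)
  finally have "psum (fps_expansion (\<lambda>z. weierstrass_factor \<rho> (z * c)) 0) =
     psum (1 - fps_const c * fps_X ^ 1) - fps_X * fps_deriv (fps_of_poly q)"
    by (simp add: psum_exp_poly[OF q0])
  also have "psum (1 - fps_const c * fps_X ^ 1) = Abs_fps (\<lambda>n. if n > 0 then c ^ n else 0)"
    by (subst psum_binomial) (auto simp: fps_eq_iff)
  finally show ?thesis
    by (cases n) (auto simp: coeff_q not_le simp del: power_Suc of_nat_Suc)
qed

text \<open>Being entire, \<open>\<psi>\<close> is bounded on discs, which yields convergence from
  summability; \<open>\<psi> 0 \<noteq> 0\<close> bounds it below near 0, which yields the converse.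
  The order of vanishing is read off from Newton's identities, the power sums up to \<rho> being
  0.\<close>

lemma weierstrass_factor_decomp:
  obtains \<psi> where "\<psi> holomorphic_on UNIV" "\<psi> 0 \<noteq> 0"
    "\<And>w. weierstrass_factor \<rho> w - 1 = w ^ Suc \<rho> * \<psi> w"
proof -
  define E where "E = fps_expansion (weierstrass_factor \<rho>) 0"
  have holo: "weierstrass_factor \<rho> holomorphic_on UNIV"
    using weierstrass_factor_holomorphic[of "\<lambda>z. z"] by simp
  have E0: "fps_nth E 0 = 1"
    by (simp add: E_def)
  have P: "fps_nth (psum E) n = (if n > \<rho> then 1 else 0)" for n
    using psum_weierstrass_factor[of \<rho> 1 n] by (simp add: E_def)
  have low: "fps_nth E n = 0" if "n \<in> {1..\<rho>}" for n
  proof -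
    have "of_nat n * fps_nth E n = 0"
      unfolding psum_newton[OF E0] using that by (simp add: P)
    with that show ?thesis
      by simp
  qed
  \<comment> \<open>In this range only k = \<rho> + 1 has a nonzero power sum, so the coefficient is
    -1 / (\<rho> + 1).\<close>
  have "of_nat (Suc \<rho>) * fps_nth E (Suc \<rho>) = - (\<Sum>k\<in>{Suc \<rho>}. fps_nth (psum E) k * fps_nth E (Suc \<rho> - k))"
    unfolding psum_newton[OF E0] by (intro arg_cong[of _ _ uminus] sum.mono_neutral_right) (auto simp: P)
  hence nz: "fps_nth E (Suc \<rho>) \<noteq> 0"
    by (auto simp: P E0)
  have conv: "fps_conv_radius E = \<infinity>"
    using conv_radius_fps_expansion[of "weierstrass_factor \<rho>" 0 \<infinity>] holo by (simp add: E_def)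
  have conv': "fps_conv_radius (E - 1) = \<infinity>"
    using fps_conv_radius_diff[of E 1] conv by simp
  have eval: "eval_fps (E - 1) w = weierstrass_factor \<rho> w - 1" for w
    using eval_fps_expansion'[of "weierstrass_factor \<rho>" 0 \<infinity> w] holo
    by (subst eval_fps_diff) (simp_all add: conv, simp add: E_def)
  define S where "S = fps_shift (Suc \<rho>) (E - 1)"
  have S: "S * fps_X ^ Suc \<rho> = E - 1"
    unfolding S_def
  proof (rule fps_ext)
    fix n
    show "fps_nth (fps_shift (Suc \<rho>) (E - 1) * fps_X ^ Suc \<rho>) n = fps_nth (E - 1) n"
      unfolding fps_X_power_mult_right_nth using low[of n] E0 by (auto simp: not_le)
  qed
  have convS: "fps_conv_radius S = \<infinity>"
    by (simp add: S_def conv')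
  show ?thesis
  proof (rule that)
    show "eval_fps S holomorphic_on UNIV"
      by (rule holomorphic_on_eval_fps) (simp_all add: convS)
    show "eval_fps S 0 \<noteq> 0"
      using nz by (simp add: eval_fps_at_0 S_def)
    show "weierstrass_factor \<rho> w - 1 = w ^ Suc \<rho> * eval_fps S w" for w
    proof -
      have "weierstrass_factor \<rho> w - 1 = eval_fps (S * fps_X ^ Suc \<rho>) w"
        by (simp only: S eval)
      also have "\<dots> = eval_fps S w * w ^ Suc \<rho>"
        by (subst eval_fps_mult) (simp_all add: convS del: power_Suc)
      finally show ?thesis
        by (simp only: mult.commute)
    qed
  qed
qed

section \<open>Infinite products\<close>

lemma norm_prod_minus_one_le_exp:
  fixes u :: "'i \<Rightarrow> complex"
  shows "norm ((\<Prod>i\<in>D. u i) - 1) \<le> exp (\<Sum>i\<in>D. norm (u i - 1)) - 1"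
proof (induction D rule: infinite_finite_induct)
  case (insert x D)
  let ?p = "\<Prod>i\<in>D. u i" and ?s = "\<Sum>i\<in>D. norm (u i - 1)"
  have "norm (u x * ?p - 1) = norm (u x * (?p - 1) + (u x - 1))"
    by (simp add: algebra_simps)
  also have "\<dots> \<le> norm (u x) * norm (?p - 1) + norm (u x - 1)"
    by (metis norm_mult norm_triangle_ineq)
  also have "\<dots> \<le> (1 + norm (u x - 1)) * (exp ?s - 1) + norm (u x - 1)"
    using norm_triangle_sub[of "u x" 1] insert.IH
    by (intro add_mono mult_mono) (simp_all add: sum_nonneg)
  also have "\<dots> = (1 + norm (u x - 1)) * exp ?s - 1"
    by (simp add: algebra_simps)
  also have "\<dots> \<le> exp (norm (u x - 1)) * exp ?s - 1"
    by (simp add: exp_ge_add_one_self)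
  finally show ?case
    using insert.hyps by (simp add: exp_add)
qed simp_all

lemma summable_on_tail_less:
  fixes M :: "'i \<Rightarrow> real"
  assumes "M summable_on I" "\<And>i. i \<in> I \<Longrightarrow> M i \<ge> 0" "\<delta> > 0"
  obtains S where "finite S" "S \<subseteq> I" "\<And>D. finite D \<Longrightarrow> D \<subseteq> I - S \<Longrightarrow> sum M D < \<delta>"
proof -
  obtain S where S: "finite S" "S \<subseteq> I" "dist (sum M S) (infsum M I) \<le> \<delta> / 2"
    using infsum_finite_approximation[OF assms(1), of "\<delta> / 2"] assms(3) by auto
  have "sum M D < \<delta>" if D: "finite D" "D \<subseteq> I - S" for D
  proof -
    have "sum M (S \<union> D) \<le> infsum M I"
      using S D assms by (intro finite_sum_le_infsum) auto
    moreover have "sum M (S \<union> D) = sum M S + sum M D"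
      using S D by (intro sum.union_disjoint) auto
    ultimately show ?thesis
      using S(3) assms(3) unfolding dist_real_def by linarith
  qed
  with S show ?thesis
    using that by blast
qed

text \<open>An M-test for products over the net of finite subsets: partial products are bounded by
  exp of the total sum of M, and enlarging a finite set by D multiplies by a number within exp (sum
  of M over D) - 1 of 1.\<close>

lemma uniform_limit_infprod:
  fixes u :: "'i \<Rightarrow> complex \<Rightarrow> complex"
  assumes M: "M summable_on I" "\<And>i. i \<in> I \<Longrightarrow> M i \<ge> 0"
    and u: "\<And>i z. i \<in> I \<Longrightarrow> z \<in> K \<Longrightarrow> norm (u i z - 1) \<le> M i"
  shows "uniform_limit K (\<lambda>S z. \<Prod>i\<in>S. u i z) (\<lambda>z. infprod (\<lambda>i. u i z) I) (finite_subsets_at_top I)"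
proof -
  define T where "T = infsum M I"
  have close: "\<exists>S. finite S \<and> S \<subseteq> I \<and> (\<forall>S'. finite S' \<and> S \<subseteq> S' \<and> S' \<subseteq> I \<longrightarrow>
      (\<forall>z\<in>K. dist (\<Prod>i\<in>S'. u i z) (\<Prod>i\<in>S. u i z) < e))" if "e > 0" for e
  proof -
    define \<delta> where "\<delta> = ln (1 + e / exp T)"
    have "\<delta> > 0" "exp T * (exp \<delta> - 1) = e"
      using that by (simp_all add: \<delta>_def field_simps add_pos_pos)
    obtain S where S: "finite S" "S \<subseteq> I" "\<And>D. finite D \<Longrightarrow> D \<subseteq> I - S \<Longrightarrow> sum M D < \<delta>"
      using summable_on_tail_less[OF M \<open>\<delta> > 0\<close>] by blast
    have dist_less: "dist (\<Prod>i\<in>S'. u i z) (\<Prod>i\<in>S. u i z) < e"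
      if S': "finite S'" "S \<subseteq> S'" "S' \<subseteq> I" and z: "z \<in> K" for S' z
    proof -
      have "(\<Prod>i\<in>S'. u i z) = (\<Prod>i\<in>S. u i z) * (\<Prod>i\<in>S' - S. u i z)"
        using S' S(1) by (simp add: prod.subset_diff mult.commute)
      hence "dist (\<Prod>i\<in>S'. u i z) (\<Prod>i\<in>S. u i z) =
               norm (\<Prod>i\<in>S. u i z) * norm ((\<Prod>i\<in>S' - S. u i z) - 1)"
        by (simp add: dist_norm right_diff_distrib flip: norm_mult)
      also have "\<dots> \<le> exp T * norm ((\<Prod>i\<in>S' - S. u i z) - 1)"
      proof (rule mult_right_mono)
        have "(\<Sum>i\<in>S. norm (u i z - 1)) \<le> sum M S"
          using S(2) z by (intro sum_mono u) auto
        also have "\<dots> \<le> T"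
          unfolding T_def using S M by (intro finite_sum_le_infsum) auto
        finally have "exp (\<Sum>i\<in>S. norm (u i z - 1)) \<le> exp T"
          by simp
        thus "norm (\<Prod>i\<in>S. u i z) \<le> exp T"
          using norm_triangle_sub[of "\<Prod>i\<in>S. u i z" 1] norm_prod_minus_one_le_exp[of "\<lambda>i. u i z" S]
          unfolding norm_one by linarith
      qed simp
      also have "\<dots> < exp T * (exp \<delta> - 1)"
      proof (rule mult_strict_left_mono)
        have "(\<Sum>i\<in>S' - S. norm (u i z - 1)) \<le> sum M (S' - S)"
          using S' z by (intro sum_mono u) auto
        also have "\<dots> < \<delta>"
          using S' by (intro S(3)) auto
        finally have "exp (\<Sum>i\<in>S' - S. norm (u i z - 1)) < exp \<delta>"
          by simp
        thus "norm ((\<Prod>i\<in>S' - S. u i z) - 1) < exp \<delta> - 1"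
          using norm_prod_minus_one_le_exp[of "\<lambda>i. u i z" "S' - S"] by linarith
      qed simp
      finally show ?thesis
        using \<open>exp T * (exp \<delta> - 1) = e\<close> by simp
    qed
    show ?thesis
    proof (intro exI[of _ S] conjI allI impI ballI S(1,2))
      fix S' z assume "finite S' \<and> S \<subseteq> S' \<and> S' \<subseteq> I" "z \<in> K"
      thus "dist (\<Prod>i\<in>S'. u i z) (\<Prod>i\<in>S. u i z) < e"
        by (intro dist_less) simp_all
    qed
  qed
  \<comment> \<open>\<open>infprod\<close> is defined by \<open>Lim\<close>, so a limit must first
    be shown to exist; it does by the Cauchy criterion and completeness.\<close>
  have lim: "((\<lambda>S. \<Prod>i\<in>S. u i z) \<longlongrightarrow> infprod (\<lambda>i. u i z) I) (finite_subsets_at_top I)" if z: "z \<in> K" for z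
  proof -
    have "cauchy_filter (filtermap (\<lambda>S. \<Prod>i\<in>S. u i z) (finite_subsets_at_top I))"
      unfolding cauchy_filter_metric_filtermap
    proof (intro allI impI)
      fix e :: real assume "e > 0"
      then obtain S where S: "finite S" "S \<subseteq> I" and
        *: "\<And>S'. finite S' \<Longrightarrow> S \<subseteq> S' \<Longrightarrow> S' \<subseteq> I \<Longrightarrow> dist (\<Prod>i\<in>S'. u i z) (\<Prod>i\<in>S. u i z) < e / 2"
        using close[of "e / 2"] z by (metis half_gt_zero)
      show "\<exists>P. eventually P (finite_subsets_at_top I) \<and>
          (\<forall>x y. P x \<and> P y \<longrightarrow> dist (\<Prod>i\<in>x. u i z) (\<Prod>i\<in>y. u i z) < e)"
      proof (intro exI[of _ "\<lambda>S'. finite S' \<and> S \<subseteq> S' \<and> S' \<subseteq> I"] conjI allI impI)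
        show "eventually (\<lambda>S'. finite S' \<and> S \<subseteq> S' \<and> S' \<subseteq> I) (finite_subsets_at_top I)"
          unfolding eventually_finite_subsets_at_top using S by blast
      next
        fix S1 S2
        assume "(finite S1 \<and> S \<subseteq> S1 \<and> S1 \<subseteq> I) \<and> finite S2 \<and> S \<subseteq> S2 \<and> S2 \<subseteq> I"
        hence "dist (\<Prod>i\<in>S1. u i z) (\<Prod>i\<in>S. u i z) < e / 2"
              "dist (\<Prod>i\<in>S2. u i z) (\<Prod>i\<in>S. u i z) < e / 2"
          by (intro *; simp)+
        thus "dist (\<Prod>i\<in>S1. u i z) (\<Prod>i\<in>S2. u i z) < e"
          by (rule dist_triangle_half_l)
      qed
    qed
    moreover have "complete (UNIV :: complex set)"
      by (rule complete_UNIV)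
    ultimately obtain L where L: "((\<lambda>S. \<Prod>i\<in>S. u i z) \<longlongrightarrow> L) (finite_subsets_at_top I)"
      unfolding complete_uniform filterlim_def
      using finite_subsets_at_top_neq_bot[of I] by (force simp: filtermap_bot_iff)
    hence "infprod (\<lambda>i. u i z) I = L"
      unfolding infprod_def by (intro tendsto_Lim) simp_all
    with L show ?thesis
      by simp
  qed
  show ?thesis
    unfolding uniform_limit_iff
  proof (intro allI impI)
    fix e :: real assume "e > 0"
    then obtain S where S: "finite S" "S \<subseteq> I" and
      *: "\<And>S' z. finite S' \<Longrightarrow> S \<subseteq> S' \<Longrightarrow> S' \<subseteq> I \<Longrightarrow> z \<in> K \<Longrightarrow>
            dist (\<Prod>i\<in>S'. u i z) (\<Prod>i\<in>S. u i z) < e / 3"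
      using close[of "e / 3"] by (metis zero_less_divide_iff zero_less_numeral)
    have ev: "eventually (\<lambda>S'. finite S' \<and> S \<subseteq> S' \<and> S' \<subseteq> I) (finite_subsets_at_top I)"
      unfolding eventually_finite_subsets_at_top using S by blast
    have lim_close: "dist (infprod (\<lambda>i. u i z) I) (\<Prod>i\<in>S. u i z) \<le> e / 3" if "z \<in> K" for z
    proof (rule tendsto_upperbound)
      show "((\<lambda>S'. dist (\<Prod>i\<in>S'. u i z) (\<Prod>i\<in>S. u i z)) \<longlongrightarrow>
              dist (infprod (\<lambda>i. u i z) I) (\<Prod>i\<in>S. u i z)) (finite_subsets_at_top I)"
        by (intro tendsto_intros lim that)
      show "\<forall>\<^sub>F S' in finite_subsets_at_top I. dist (\<Prod>i\<in>S'. u i z) (\<Prod>i\<in>S. u i z) \<le> e / 3"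
        using ev by eventually_elim (use * that in \<open>auto intro: less_imp_le\<close>)
    qed simp
    show "\<forall>\<^sub>F S' in finite_subsets_at_top I. \<forall>z\<in>K. dist (\<Prod>i\<in>S'. u i z) (infprod (\<lambda>i. u i z) I) < e"
      using ev
    proof eventually_elim
      case (elim S')
      show ?case
      proof
        fix z assume z: "z \<in> K"
        have "dist (\<Prod>i\<in>S'. u i z) (infprod (\<lambda>i. u i z) I) \<le>
                dist (\<Prod>i\<in>S'. u i z) (\<Prod>i\<in>S. u i z) + dist (infprod (\<lambda>i. u i z) I) (\<Prod>i\<in>S. u i z)"
          by (rule dist_triangle2)
        also have "\<dots> < e / 3 + e / 3"
          using elim z by (intro add_less_le_mono * lim_close) auto
        also have "\<dots> < e"
          using \<open>e > 0\<close> by simp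
        finally show "dist (\<Prod>i\<in>S'. u i z) (infprod (\<lambda>i. u i z) I) < e" .
      qed
    qed
  qed
qed

section \<open>Weierstrass products with summable powers\<close>

lemma norm_le_of_summable_power:
  fixes c :: "'i \<Rightarrow> complex"
  assumes "(\<lambda>i. norm (c i) ^ Suc \<rho>) summable_on I"
  obtains B where "B > 0" "\<And>i. i \<in> I \<Longrightarrow> norm (c i) \<le> B"
proof
  \<comment> \<open>The bound is 1 + T: a norm above 1 is at most its own power of exponent \<rho> +
    1, which is at most T.\<close>
  let ?T = "infsum (\<lambda>i. norm (c i) ^ Suc \<rho>) I"
  have T: "?T \<ge> 0"
    by (intro infsum_nonneg) simp
  thus "1 + ?T > 0"
    by linarith
  fix i assume i: "i \<in> I"
  show "norm (c i) \<le> 1 + ?T"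
  proof (cases "norm (c i) \<le> 1")
    case False
    hence "norm (c i) \<le> norm (c i) ^ Suc \<rho>"
      by (intro self_le_power) auto
    also have "\<dots> \<le> ?T"
      using finite_sum_le_infsum[OF assms, of "{i}"] i by simp
    finally show ?thesis
      by simp
  qed (use T in simp)
qed

text \<open>For z in a compact set all arguments z c_i lie in one disc, where \<open>\<psi>\<close>
  is bounded; so each factor differs from 1 by at most a constant times |c_i|^(\<rho> + 1).\<close>

lemma abs_unif_convergent_weierstrass:
  fixes c :: "'i \<Rightarrow> complex"
  assumes c: "(\<lambda>i. norm (c i) ^ Suc \<rho>) summable_on I"
  shows "abs_unif_convergent_prod (\<lambda>i z. weierstrass_factor \<rho> (z * c i)) I"
proof -
  obtain B where B: "B > 0" "\<And>i. i \<in> I \<Longrightarrow> norm (c i) \<le> B"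
    using norm_le_of_summable_power[OF c] by blast
  obtain \<psi> where \<psi>: "\<psi> holomorphic_on UNIV"
    "\<And>w. weierstrass_factor \<rho> w - 1 = w ^ Suc \<rho> * \<psi> w"
    using weierstrass_factor_decomp[of \<rho>] by metis
  have bound: "\<exists>C\<ge>0. \<forall>i\<in>I. \<forall>z\<in>K. norm (weierstrass_factor \<rho> (z * c i) - 1) \<le> C * norm (c i) ^ Suc \<rho>"
    if "compact K" for K
  proof -
    obtain R where R: "R > 0" "\<And>z. z \<in> K \<Longrightarrow> norm z \<le> R"
      using compact_imp_bounded[OF \<open>compact K\<close>] unfolding bounded_pos by blast
    have "bounded (\<psi> ` cball 0 (R * B))"
      using \<psi>(1) by (intro compact_imp_bounded compact_continuous_image compact_cball
          holomorphic_on_imp_continuous_on) (auto intro: holomorphic_on_subset)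
    then obtain C where C: "C > 0" "\<And>w. norm w \<le> R * B \<Longrightarrow> norm (\<psi> w) \<le> C"
      unfolding bounded_pos by auto
    have "norm (weierstrass_factor \<rho> (z * c i) - 1) \<le> (R ^ Suc \<rho> * C) * norm (c i) ^ Suc \<rho>"
      if "i \<in> I" "z \<in> K" for i z
    proof -
      have "norm (weierstrass_factor \<rho> (z * c i) - 1) = norm z ^ Suc \<rho> * norm (c i) ^ Suc \<rho> * norm (\<psi> (z * c i))"
        unfolding \<psi>(2) by (simp only: norm_mult norm_power power_mult_distrib)
      also have "\<dots> \<le> R ^ Suc \<rho> * norm (c i) ^ Suc \<rho> * C"
      proof (intro mult_mono power_mono C(2))
        show "norm (z * c i) \<le> R * B"
          unfolding norm_mult using R B that by (intro mult_mono) auto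
      qed (use R B C that in auto)
      finally show ?thesis
        by (simp only: mult_ac)
    qed
    thus ?thesis
      using R(1) C(1) by (intro exI[of _ "R ^ Suc \<rho> * C"]) auto
  qed
  show ?thesis
    unfolding abs_unif_convergent_prod_def
  proof (intro conjI allI impI)
    fix z
    obtain C where "\<forall>i\<in>I. norm (weierstrass_factor \<rho> (z * c i) - 1) \<le> C * norm (c i) ^ Suc \<rho>"
      using bound[of "{z}"] by auto
    thus "(\<lambda>i. norm (weierstrass_factor \<rho> (z * c i) - 1)) summable_on I"
      by (intro summable_on_comparison_test[OF summable_on_cmult_right[OF c, of C]]) auto
  next
    fix K :: "complex set" assume "compact K"
    then obtain C where C: "C \<ge> 0"
      "\<forall>i\<in>I. \<forall>z\<in>K. norm (weierstrass_factor \<rho> (z * c i) - 1) \<le> C * norm (c i) ^ Suc \<rho>"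
      using bound by blast
    show "uniform_limit K (\<lambda>S z. \<Prod>i\<in>S. weierstrass_factor \<rho> (z * c i))
            (\<lambda>z. infprod (\<lambda>i. weierstrass_factor \<rho> (z * c i)) I) (finite_subsets_at_top I)"
      by (rule uniform_limit_infprod[OF summable_on_cmult_right[OF c, of C]]) (use C in auto)
  qed
qed

lemma holomorphic_infprod:
  assumes conv: "abs_unif_convergent_prod u I" and holo: "\<And>i. i \<in> I \<Longrightarrow> u i holomorphic_on UNIV"
  shows "(\<lambda>z. infprod (\<lambda>i. u i z) I) holomorphic_on UNIV"
proof -
  have "(\<lambda>z. infprod (\<lambda>i. u i z) I) field_differentiable at z" for z
  proof -
    have prod: "(\<lambda>w. \<Prod>i\<in>S. u i w) holomorphic_on A" if "finite S \<and> S \<subseteq> I" for S A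
      using that by (intro holomorphic_on_prod holomorphic_on_subset[OF holo]) auto
    have ev: "\<forall>\<^sub>F S in finite_subsets_at_top I. finite S \<and> S \<subseteq> I"
      by (rule eventually_finite_subsets_at_top_weakI) simp
    have "(\<lambda>z. infprod (\<lambda>i. u i z) I) holomorphic_on ball z 1"
    proof (rule holomorphic_uniform_limit)
      show "\<forall>\<^sub>F S in finite_subsets_at_top I. continuous_on (cball z 1) (\<lambda>w. \<Prod>i\<in>S. u i w) \<and>
              (\<lambda>w. \<Prod>i\<in>S. u i w) holomorphic_on ball z 1"
        using ev by eventually_elim (intro conjI holomorphic_on_imp_continuous_on prod; simp)
      show "uniform_limit (cball z 1) (\<lambda>S w. \<Prod>i\<in>S. u i w) (\<lambda>w. infprod (\<lambda>i. u i w) I)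
              (finite_subsets_at_top I)"
        using conv by (simp add: abs_unif_convergent_prod_def)
    qed auto
    thus ?thesis
      by (rule holomorphic_on_imp_differentiable_at) auto
  qed
  thus ?thesis
    by (simp add: holomorphic_on_def)
qed

section \<open>Power sums of Hadamard products\<close>

lemma abs_summable_higher_power:
  fixes c :: "'i \<Rightarrow> complex"
  assumes c: "(\<lambda>i. norm (c i) ^ Suc \<rho>) summable_on I" and n: "n > \<rho>"
  shows "(\<lambda>i. norm (c i ^ n)) summable_on I"
proof -
  obtain B where B: "B > 0" "\<And>i. i \<in> I \<Longrightarrow> norm (c i) \<le> B"
    using norm_le_of_summable_power[OF c] by blast
  show ?thesis
  proof (rule summable_on_comparison_test[OF summable_on_cmult_right[OF c, of "B ^ (n - Suc \<rho>)"]])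
    fix i assume "i \<in> I"
    have "norm (c i ^ n) = norm (c i) ^ (n - Suc \<rho>) * norm (c i) ^ Suc \<rho>"
      unfolding norm_power power_add[symmetric] using n by simp
    also have "\<dots> \<le> B ^ (n - Suc \<rho>) * norm (c i) ^ Suc \<rho>"
      using B \<open>i \<in> I\<close> by (intro mult_right_mono power_mono) auto
    finally show "norm (c i ^ n) \<le> B ^ (n - Suc \<rho>) * norm (c i) ^ Suc \<rho>" .
  qed simp
qed

text \<open>
  Newton's identities express the power sums polynomially in the coefficients, so they pass to the
  limit along the finite partial products.
\<close>
lemma psum_infprod_weierstrass:
  fixes c :: "'i \<Rightarrow> complex"
  assumes c: "(\<lambda>i. norm (c i) ^ Suc \<rho>) summable_on I"
    and conv: "abs_unif_convergent_prod (\<lambda>i z. weierstrass_factor \<rho> (z * c i)) I"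
  defines "v \<equiv> \<lambda>z. infprod (\<lambda>i. weierstrass_factor \<rho> (z * c i)) I"
  shows "psum (fps_expansion v 0) = Abs_fps (\<lambda>n. if n > \<rho> then \<Sum>\<^sub>\<infinity>i\<in>I. c i ^ n else 0)"
    and "v holomorphic_on UNIV" and "v 0 = 1"
proof -
  let ?w = "\<lambda>i z. weierstrass_factor \<rho> (z * c i)"
  let ?F = "finite_subsets_at_top I"
  define E where "E = (\<lambda>S. fps_expansion (\<lambda>z. \<Prod>i\<in>S. ?w i z) 0)"
  define P where "P = Abs_fps (\<lambda>n. if n > \<rho> then \<Sum>\<^sub>\<infinity>i\<in>I. c i ^ n else 0)"
  let ?V = "fps_expansion v 0"
  have holo: "?w i holomorphic_on A" for i A
    by (intro holomorphic_intros)
  show "v holomorphic_on UNIV"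
    unfolding v_def by (rule holomorphic_infprod[OF conv holo])
  \<comment> \<open>Locally uniform convergence of holomorphic functions passes to all derivatives,
    hence to each Taylor coefficient at 0.\<close>
  have E_nth: "((\<lambda>S. fps_nth (E S) n) \<longlongrightarrow> fps_nth ?V n) ?F" for n
  proof -
    have "uniform_limit (ball 0 1) (\<lambda>S z. \<Prod>i\<in>S. ?w i z) v ?F"
      by (rule uniform_limit_on_subset[where J = "cball 0 1"])
         (use conv in \<open>auto simp: abs_unif_convergent_prod_def v_def\<close>)
    hence "((\<lambda>S. (deriv ^^ n) (\<lambda>z. \<Prod>i\<in>S. ?w i z) 0) \<longlongrightarrow> (deriv ^^ n) v 0) ?F"
      by (rule higher_deriv_complex_uniform_limit) (auto intro!: always_eventually holomorphic_on_prod holo)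
    thus ?thesis
      unfolding E_def fps_expansion_def fps_nth_Abs_fps by (intro tendsto_intros) auto
  qed
  have E_prod: "E S = (\<Prod>i\<in>S. fps_expansion (?w i) 0)" for S
    unfolding E_def by (rule fps_expansion_prod_entire) (rule holo)
  have E_0: "fps_nth (E S) 0 = 1" for S
    by (simp add: E_def)
  have "fps_nth ?V 0 = 1"
    using E_nth[of 0] tendsto_unique[OF finite_subsets_at_top_neq_bot] by (simp add: E_0 tendsto_const_iff)
  thus "v 0 = 1"
    by simp
  have psum_E: "fps_nth (psum (E S)) n = (\<Sum>i\<in>S. if n > \<rho> then c i ^ n else 0)" for S n
    unfolding E_prod by (subst psum_prod(1)) (simp_all add: fps_sum_nth psum_weierstrass_factor)
  have psum_lim: "((\<lambda>S. fps_nth (psum (E S)) n) \<longlongrightarrow> fps_nth P n) ?F" for n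
  proof (cases "n > \<rho>")
    case True
    have "(\<lambda>i. c i ^ n) summable_on I"
      by (rule abs_summable_summable) (rule abs_summable_higher_power[OF c True])
    thus ?thesis
      using True by (simp add: psum_E P_def has_sum_infsum flip: has_sum_def)
  qed (simp add: psum_E P_def)
  have "psum ?V = P"
  proof (rule psum_eqI)
    show "fps_X * fps_deriv ?V = - (P * ?V)"
    proof (rule fps_ext)
      fix n
      have "((\<lambda>S. - (\<Sum>k=0..n. fps_nth (psum (E S)) k * fps_nth (E S) (n - k))) \<longlongrightarrow>
              - (\<Sum>k=0..n. fps_nth P k * fps_nth ?V (n - k))) ?F"
        by (intro tendsto_intros psum_lim E_nth)
      moreover have "((\<lambda>S. of_nat n * fps_nth (E S) n) \<longlongrightarrow> of_nat n * fps_nth ?V n) ?F"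
        by (intro tendsto_intros E_nth)
      ultimately have "of_nat n * fps_nth ?V n = - (\<Sum>k=0..n. fps_nth P k * fps_nth ?V (n - k))"
        unfolding psum_newton[OF E_0, symmetric]
        using tendsto_unique[OF finite_subsets_at_top_neq_bot] by blast
      moreover have "fps_nth (fps_X * fps_deriv ?V) n = of_nat n * fps_nth ?V n"
        by (cases n) (simp_all add: fps_X_mult_nth)
      ultimately show "fps_nth (fps_X * fps_deriv ?V) n = fps_nth (- (P * ?V)) n"
        by (simp only: fps_mult_nth fps_neg_nth)
    qed
  qed fact
  thus "psum ?V = Abs_fps (\<lambda>n. if n > \<rho> then \<Sum>\<^sub>\<infinity>i\<in>I. c i ^ n else 0)"
    by (simp only: P_def)
qed

lemma psum_exp_poly_nth:
  assumes "poly q 0 = 0"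
  shows "fps_nth (psum (fps_expansion (\<lambda>z. exp (poly q z)) 0)) n = - (of_nat n * coeff q n)"
  unfolding psum_exp_poly[OF assms] by (cases n) simp_all

text \<open>The two factors contribute in disjoint degrees: the exponential only up to the degree of
  \<open>q\<close>, the product only above \<rho>.\<close>

lemma psum_hadamard:
  fixes c :: "'i \<Rightarrow> complex"
  assumes c: "(\<lambda>i. norm (c i) ^ Suc \<rho>) summable_on I"
    and conv: "abs_unif_convergent_prod (\<lambda>i z. weierstrass_factor \<rho> (z * c i)) I"
    and q: "poly q 0 = 0" "Polynomial.degree q \<le> \<rho>"
    and h: "\<And>z. h z = exp (poly q z) * infprod (\<lambda>i. weierstrass_factor \<rho> (z * c i)) I"
  shows "fps_nth (psum (fps_expansion h 0)) n =
           (if n > \<rho> then \<Sum>\<^sub>\<infinity>i\<in>I. c i ^ n else - (of_nat n * coeff q n))"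
    and "h holomorphic_on UNIV" and "h 0 = 1"
proof -
  let ?v = "\<lambda>z. infprod (\<lambda>i. weierstrass_factor \<rho> (z * c i)) I"
  note v = psum_infprod_weierstrass[OF c conv]
  have h': "h = (\<lambda>z. exp (poly q z) * ?v z)"
    using h by blast
  have e: "(\<lambda>z. exp (poly q z)) holomorphic_on UNIV"
    by (intro holomorphic_intros)
  show "h holomorphic_on UNIV"
    unfolding h' by (intro holomorphic_on_mult e v(2))
  show "h 0 = 1"
    using h[of 0] q(1) v(3) by simp
  have "psum (fps_expansion h 0) = psum (fps_expansion (\<lambda>z. exp (poly q z)) 0) + psum (fps_expansion ?v 0)"
    unfolding h' fps_expansion_mult_entire[OF e v(2)] by (rule psum_mult) (use q(1) v(3) in simp_all)
  thus "fps_nth (psum (fps_expansion h 0)) n =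
           (if n > \<rho> then \<Sum>\<^sub>\<infinity>i\<in>I. c i ^ n else - (of_nat n * coeff q n))"
    using q by (simp add: psum_exp_poly_nth v(1) coeff_eq_0)
qed

section \<open>Zeros of entire functions and summability of their inverse powers\<close>

lemma zeros_family_zero:
  assumes "f holomorphic_on UNIV" "zeros_family f I \<alpha>" "i \<in> I"
  shows "f (\<alpha> i) = 0"
proof (rule ccontr)
  assume "f (\<alpha> i) \<noteq> 0"
  hence "zorder f (\<alpha> i) = 0"
    using assms(1) by (intro zorder_eqI[of UNIV _ f]) auto
  moreover have "finite {j \<in> I. \<alpha> j = \<alpha> i}" "int (card {j \<in> I. \<alpha> j = \<alpha> i}) = zorder f (\<alpha> i)"
    using assms(2) by (simp_all add: zeros_family_def)
  ultimately have "{j \<in> I. \<alpha> j = \<alpha> i} = {}"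
    by simp
  with assms(3) show False
    by blast
qed

text \<open>A nonconstant entire function has finitely many zeros in a disc, each listed finitely
  often. A constant \<open>f\<close> is nonzero here, so its family is empty.\<close>

lemma zeros_family_finite_bounded:
  assumes f: "f holomorphic_on UNIV" "f 0 \<noteq> 0" and z: "zeros_family f I \<alpha>"
  shows "finite {i \<in> I. norm (\<alpha> i) \<le> R}"
proof (cases "f constant_on UNIV")
  case True
  hence "f (\<alpha> i) = f 0" for i
    by (metis UNIV_I constant_on_def)
  hence "I = {}"
    using zeros_family_zero[OF f(1) z] f(2) by auto
  thus ?thesis
    by simp
next
  case False
  have "finite {w \<in> cball 0 R. f w = 0}"
    using f False by (intro holomorphic_compact_finite_zeros[of f UNIV]) auto
  moreover have "finite {i \<in> I. \<alpha> i = w}" for w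
    using z by (simp add: zeros_family_def)
  ultimately have "finite (\<Union>w\<in>{w \<in> cball 0 R. f w = 0}. {i \<in> I. \<alpha> i = w})"
    by (intro finite_UN_I)
  thus ?thesis
    by (rule rev_finite_subset) (use zeros_family_zero[OF f(1) z] in auto)
qed

text \<open>
  Since \<open>E\<^sub>\<rho>(w) - 1\<close> vanishes at \<open>0\<close> to order exactly \<open>\<rho> + 1\<close>, absolute convergence of the product
  at \<open>z = 1\<close> is equivalent to \<open>\<Sum>\<^sub>i 1 / \<bar>\<alpha>\<^sub>i\<bar>\<^bsup>\<rho>+1\<^esup> < \<infinity>\<close>.
\<close>
lemma summable_inverse_zeros:
  assumes f: "f holomorphic_on UNIV" "f 0 \<noteq> 0" and z: "zeros_family f I \<alpha>"
    and conv: "abs_unif_convergent_prod (\<lambda>i z. weierstrass_factor \<rho> (z / \<alpha> i)) I"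
  shows "(\<lambda>i. norm (inverse (\<alpha> i)) ^ Suc \<rho>) summable_on I"
proof -
  obtain \<psi> where \<psi>: "\<psi> holomorphic_on UNIV" "\<psi> 0 \<noteq> 0"
    "\<And>w. weierstrass_factor \<rho> w - 1 = w ^ Suc \<rho> * \<psi> w"
    using weierstrass_factor_decomp[of \<rho>] by metis
  define \<kappa> where "\<kappa> = norm (\<psi> 0) / 2"
  have "\<kappa> > 0"
    using \<psi>(2) by (simp add: \<kappa>_def)
  have "isCont \<psi> 0"
    using holomorphic_on_imp_continuous_on[OF \<psi>(1)] by (simp add: continuous_on_eq_continuous_at)
  then obtain \<delta> where \<delta>: "\<delta> > 0" "\<And>w. dist w 0 < \<delta> \<Longrightarrow> dist (\<psi> w) (\<psi> 0) < \<kappa>"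
    using \<open>\<kappa> > 0\<close> unfolding continuous_at_eps_delta by blast
  have lower: "norm (\<psi> w) \<ge> \<kappa>" if "norm w < \<delta>" for w
  proof -
    have "norm (\<psi> 0 - \<psi> w) < \<kappa>"
      using \<delta>(2)[of w] that by (simp add: dist_norm norm_minus_commute)
    thus ?thesis
      using norm_triangle_ineq2[of "\<psi> 0" "\<psi> w"] by (simp add: \<kappa>_def)
  qed
  let ?J = "{i \<in> I. norm (\<alpha> i) \<le> 1 / \<delta>}"
  have fin: "finite ?J"
    by (rule zeros_family_finite_bounded[OF f z])
  have "(\<lambda>i. norm (weierstrass_factor \<rho> (1 / \<alpha> i) - 1)) summable_on I"
    using conv by (simp add: abs_unif_convergent_prod_def)
  hence "(\<lambda>i. norm (weierstrass_factor \<rho> (1 / \<alpha> i) - 1)) summable_on I - ?J"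
    by (rule summable_on_subset_banach) auto
  hence "(\<lambda>i. inverse \<kappa> * norm (weierstrass_factor \<rho> (1 / \<alpha> i) - 1)) summable_on I - ?J"
    by (rule summable_on_cmult_right)
  hence "(\<lambda>i. norm (inverse (\<alpha> i)) ^ Suc \<rho>) summable_on I - ?J"
  proof (rule summable_on_comparison_test)
    fix i assume "i \<in> I - ?J"
    hence i: "norm (\<alpha> i) > 1 / \<delta>"
      by auto
    have "norm (inverse (\<alpha> i)) < \<delta>"
      using less_imp_inverse_less[OF i] \<delta>(1) by (simp add: norm_inverse)
    hence "\<kappa> \<le> norm (\<psi> (inverse (\<alpha> i)))"
      by (rule lower)
    hence "norm (inverse (\<alpha> i)) ^ Suc \<rho> * \<kappa> \<le> norm (inverse (\<alpha> i)) ^ Suc \<rho> * norm (\<psi> (inverse (\<alpha> i)))"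
      by (intro mult_left_mono) auto
    also have "\<dots> = norm (weierstrass_factor \<rho> (1 / \<alpha> i) - 1)"
      unfolding \<psi>(3) by (simp only: norm_mult norm_power inverse_eq_divide)
    finally show "norm (inverse (\<alpha> i)) ^ Suc \<rho> \<le> inverse \<kappa> * norm (weierstrass_factor \<rho> (1 / \<alpha> i) - 1)"
      using \<open>\<kappa> > 0\<close> by (simp add: field_simps)
  qed simp
  hence "(\<lambda>i. norm (inverse (\<alpha> i)) ^ Suc \<rho>) summable_on ((I - ?J) \<union> ?J)"
    by (rule summable_on_union) (rule summable_on_finite[OF fin])
  moreover have "(I - ?J) \<union> ?J = I"
    by blast
  ultimately show ?thesis
    by simp
qed

section \<open>Absolutely summable families over pairs\<close>

lemma
  fixes a :: "'i \<Rightarrow> complex" and b :: "'j \<Rightarrow> complex"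
  assumes a: "(\<lambda>i. norm (a i)) summable_on I" and b: "(\<lambda>j. norm (b j)) summable_on J"
  shows norm_summable_on_Times: "(\<lambda>p. norm (a (fst p) * b (snd p))) summable_on I \<times> J"
    and infsum_Times: "(\<Sum>\<^sub>\<infinity>p\<in>I \<times> J. a (fst p) * b (snd p)) = infsum a I * infsum b J"
proof -
  show sum: "(\<lambda>p. norm (a (fst p) * b (snd p))) summable_on I \<times> J"
  proof (rule summable_on_SigmaI)
    show "((\<lambda>j. norm (a (fst (i, j)) * b (snd (i, j)))) has_sum norm (a i) * (\<Sum>\<^sub>\<infinity>j\<in>J. norm (b j))) J" for i
      using b by (auto simp: norm_mult intro!: has_sum_cmult_right has_sum_infsum)
    show "(\<lambda>i. norm (a i) * (\<Sum>\<^sub>\<infinity>j\<in>J. norm (b j))) summable_on I"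
      by (rule summable_on_cmult_left[OF a])
  qed (rule norm_ge_zero)
  hence "(\<lambda>(i, j). a i * b j) summable_on I \<times> J"
    unfolding case_prod_unfold by (rule abs_summable_summable)
  hence "(\<Sum>\<^sub>\<infinity>(i, j)\<in>I \<times> J. a i * b j) = (\<Sum>\<^sub>\<infinity>i\<in>I. \<Sum>\<^sub>\<infinity>j\<in>J. a i * b j)"
    by (rule infsum_Sigma'_banach[symmetric])
  also have "\<dots> = infsum a I * infsum b J"
    by (simp add: infsum_cmult_right' infsum_cmult_left')
  finally show "(\<Sum>\<^sub>\<infinity>p\<in>I \<times> J. a (fst p) * b (snd p)) = infsum a I * infsum b J"
    by (simp add: case_prod_unfold)
qed

theorem theorem9p2:
  fixes f g :: "complex \<Rightarrow> complex" and \<rho> :: nat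
    and F G :: "complex poly"
    and I :: "'i set" and \<alpha> :: "'i \<Rightarrow> complex"
    and J :: "'j set" and \<beta> :: "'j \<Rightarrow> complex"
  assumes "f holomorphic_on UNIV" and "g holomorphic_on UNIV"
    and "f 0 = 1" and "g 0 = 1"
    and "has_genus f \<rho>" and "has_genus g \<rho>"
    and "zeros_family f I \<alpha>" and "zeros_family g J \<beta>"
    and "hadamard_factorization \<rho> f F I \<alpha>" and "poly F 0 = 0"
    and "hadamard_factorization \<rho> g G J \<beta>" and "poly G 0 = 0"
  shows "\<exists>H :: complex poly.
    Polynomial.degree H \<le> \<rho> \<and>
    fps_of_poly H = fps_of_poly F \<star>\<^sub>e fps_of_poly G \<and>
    fps_conv_radius (fps_expansion f 0 \<star> fps_expansion g 0) = \<infinity> \<and>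
    abs_unif_convergent_prod
      (\<lambda>(i, j) z. weierstrass_factor \<rho> (z / (\<alpha> i * \<beta> j))) (I \<times> J) \<and>
    (\<forall>z. eval_fps (fps_expansion f 0 \<star> fps_expansion g 0) z =
       exp (poly H z) *
       infprod (\<lambda>(i, j). weierstrass_factor \<rho> (z / (\<alpha> i * \<beta> j))) (I \<times> J))"
proof -
  \<comment> \<open>Inverse zeros turn every quotient into a product, and the pair (i, j) gets the
    multiplier \<open>a i * b j\<close>.\<close>
  define a where "a = (\<lambda>i. inverse (\<alpha> i))"
  define b where "b = (\<lambda>j. inverse (\<beta> j))"
  define c where "c = (\<lambda>p. a (fst p) * b (snd p))"
  have quot: "z / \<alpha> i = z * a i" "z / \<beta> j = z * b j" for z i j
    by (simp_all add: a_def b_def divide_inverse)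
  have quot_c: "(\<lambda>(i, j) z. weierstrass_factor \<rho> (z / (\<alpha> i * \<beta> j))) = (\<lambda>p z. weierstrass_factor \<rho> (z * c p))"
    "(\<lambda>(i, j). weierstrass_factor \<rho> (z / (\<alpha> i * \<beta> j))) = (\<lambda>p. weierstrass_factor \<rho> (z * c p))" for z
    by (auto simp: fun_eq_iff a_def b_def c_def divide_inverse)
  have F: "Polynomial.degree F \<le> \<rho>" "abs_unif_convergent_prod (\<lambda>i z. weierstrass_factor \<rho> (z * a i)) I"
    "\<And>z. f z = exp (poly F z) * infprod (\<lambda>i. weierstrass_factor \<rho> (z * a i)) I"
    using assms(9) by (simp_all only: hadamard_factorization_def quot simp_thms)
  have G: "Polynomial.degree G \<le> \<rho>" "abs_unif_convergent_prod (\<lambda>j z. weierstrass_factor \<rho> (z * b j)) J"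
    "\<And>z. g z = exp (poly G z) * infprod (\<lambda>j. weierstrass_factor \<rho> (z * b j)) J"
    using assms(11) by (simp_all only: hadamard_factorization_def quot simp_thms)
  have sum_a: "(\<lambda>i. norm (a i) ^ Suc \<rho>) summable_on I"
    unfolding a_def by (rule summable_inverse_zeros[of f])
      (use assms(1,3,7) F(2) in \<open>simp_all add: quot\<close>)
  have sum_b: "(\<lambda>j. norm (b j) ^ Suc \<rho>) summable_on J"
    unfolding b_def by (rule summable_inverse_zeros[of g])
      (use assms(2,4,8) G(2) in \<open>simp_all add: quot\<close>)
  have sum_c: "(\<lambda>p. norm (c p) ^ Suc \<rho>) summable_on I \<times> J"
    using norm_summable_on_Times[of "\<lambda>i. a i ^ Suc \<rho>" I "\<lambda>j. b j ^ Suc \<rho>" J] sum_a sum_b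
    by (simp only: c_def norm_power power_mult_distrib norm_mult)
  have conv_c: "abs_unif_convergent_prod (\<lambda>p z. weierstrass_factor \<rho> (z * c p)) (I \<times> J)"
    by (rule abs_unif_convergent_weierstrass[OF sum_c])
  define H where "H = (\<Sum>i\<le>\<rho>. Polynomial.monom (- (of_nat i * coeff F i * coeff G i)) i)"
  have coeff_H: "coeff H i = - (of_nat i * coeff F i * coeff G i)" for i
    using F(1) by (cases "i \<le> \<rho>") (simp_all add: H_def coeff_sum coeff_eq_0)
  have H: "Polynomial.degree H \<le> \<rho>"
    using F(1) by (intro degree_le) (simp add: coeff_H coeff_eq_0)
  have H0: "poly H 0 = 0"
    by (simp add: poly_0_coeff_0 coeff_H)
  \<comment> \<open>The claimed right-hand side. It is entire, so \<open>star\<close> also yields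
    the infinite radius of convergence.\<close>
  define h where "h = (\<lambda>z. exp (poly H z) * infprod (\<lambda>p. weierstrass_factor \<rho> (z * c p)) (I \<times> J))"
  note psum_f = psum_hadamard[OF sum_a F(2) assms(10) F(1) F(3)]
  note psum_g = psum_hadamard[OF sum_b G(2) assms(12) G(1) G(3)]
  have h: "h z = exp (poly H z) * infprod (\<lambda>p. weierstrass_factor \<rho> (z * c p)) (I \<times> J)" for z
    by (simp only: h_def)
  note psum_h = psum_hadamard[OF sum_c conv_c H0 H h]
  have star: "fps_expansion f 0 \<star> fps_expansion g 0 = fps_expansion h 0"
  proof (rule ene_prod_eqI)
    fix n
    show "fps_nth (psum (fps_expansion h 0)) n =
            fps_nth (psum (fps_expansion f 0)) n * fps_nth (psum (fps_expansion g 0)) n"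
    proof (cases "n > \<rho>")
      case True
      have "(\<Sum>\<^sub>\<infinity>p\<in>I \<times> J. c p ^ n) = (\<Sum>\<^sub>\<infinity>i\<in>I. a i ^ n) * (\<Sum>\<^sub>\<infinity>j\<in>J. b j ^ n)"
        unfolding c_def power_mult_distrib
        by (intro infsum_Times abs_summable_higher_power[OF _ True] sum_a sum_b)
      with True show ?thesis
        by (simp only: psum_f(1) psum_g(1) psum_h(1) if_True)
    next
      \<comment> \<open>Here (-n F_n) (-n G_n) = -n (-n F_n G_n), which is what dictates the
        coefficients of \<open>\<star>\<^sub>e\<close>.\<close>
      case False
      thus ?thesis
        by (simp add: psum_f(1) psum_g(1) psum_h(1) coeff_H)
    qed
  qed (simp_all add: assms(3,4) psum_h(3))
  have "fps_of_poly H = fps_of_poly F \<star>\<^sub>e fps_of_poly G"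
    by (simp add: fps_eq_iff exp_ene_prod_def coeff_H)
  moreover have "fps_conv_radius (fps_expansion h 0) = \<infinity>"
    using conv_radius_fps_expansion[of h 0 \<infinity>] psum_h(2) by simp
  moreover have "eval_fps (fps_expansion h 0) z = h z" for z
    using eval_fps_expansion'[of h 0 \<infinity> z] psum_h(2) by simp
  ultimately show ?thesis
    unfolding star quot_c using H conv_c h by (intro exI[of _ H]) simp
qed

end
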